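(* Let $r\in\mathbb{N}_0$, let $\Delta\subset\mathbb{R}^2$ be Lebesgue measurable and let $f\in M^1$. For every $0<R<\infty$, $$\|V_{h_r}f\cdot\chi_\Delta\|_1\le \frac{\rho(\Delta,R)}{C_r(R)}\,\|V_{h_r}f\|_1 ,$$ where $\rho(\Delta,R)=\sup_{z\in\mathbb{R}^2}|\Delta\cap(z+D_R)|$ and $C_r(R)=\int_0^{\pi R^2}\big(L_r^0(t)\big)^2e^{-t}\,dt$.
   Context: For $z=(x,\xi)\in\mathbb{R}^2$ put $\pi(z)g(t)=e^{2\pi i\xi t}g(t-x)$. The short-time Fourier transform of $f$ with window $g$ is $V_gf(z)=\langle f,\pi(z)g\rangle=\int_{\mathbb{R}}f(t)\overline{g(t-x)}e^{-2\pi i\xi t}dt$ (with $\langle\cdot,\cdot\rangle$ linear in the first and conjugate-linear in the second argument, extended by duality to tempered distributions $f$ and Schwartz windows $g$). The Hermite functions are $h_r(t)=\frac{2^{1/4}}{\sqrt{r!}}\left(\frac{-1}{2\sqrt{\pi}}\right)^{r}e^{\pi t^2}\frac{d^r}{dt^r}\left(e^{-2\pi t^2}\right)$, $r\ge0$; they form an orthonormal basis of $L^2(\mathbb{R})$. The modulation space $M^1$ is the set of tempered distributions $f$ on $\mathbb{R}$ with $V_{h_0}f\in L^1(\mathbb{R}^2)$; any other nonzero window $g$ with $\|V_gg\|_1<\infty$ (in particular $h_r$) gives the same space. $L_r^0(x)=\sum_{i=0}^r(-1)^i\binom{r}{i}\frac{x^i}{i!}$ is the Laguerre polynomial. $D_R\subset\mathbb{R}^2$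 is the disc of radius $R$ centered at $0$, $|\cdot|$ of a set is Lebesgue measure, $\chi_\Delta$ is the indicator function, and $\|\cdot\|_1$ is the norm of $L^1(\mathbb{R}^2)$. *)

theory Defs
  imports "HOL-Analysis.Analysis"
begin

definition iter_deriv :: "nat \<Rightarrow> (real \<Rightarrow> complex) \<Rightarrow> real \<Rightarrow> complex" where
  "iter_deriv k \<phi> = ((\<lambda>\<psi> t. vector_derivative \<psi> (at t)) ^^ k) \<phi>"

definition schwartz :: "(real \<Rightarrow> complex) set" where
  "schwartz = {\<phi>. (\<forall>k t. iter_deriv k \<phi> differentiable (at t)) \<and>
                  (\<forall>j k. bounded (range (\<lambda>t. t ^ j *\<^sub>R iter_deriv k \<phi> t)))}"

definition schwartz_seminorm :: "nat \<Rightarrow> nat \<Rightarrow> (real \<Rightarrow> complex) \<Rightarrow> real" where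
  "schwartz_seminorm j k \<phi> = (SUP t. norm (t ^ j *\<^sub>R iter_deriv k \<phi> t))"

text \<open>A tempered distribution is a linear functional on the Schwartz space that is continuous,
  i.e. dominated by finitely many of the seminorms generating the topology. It is modelled by a
  function on all of \<^typ>\<open>real \<Rightarrow> complex\<close>, of which only the values on \<^const>\<open>schwartz\<close> matter.\<close>

definition tempered_distribution :: "((real \<Rightarrow> complex) \<Rightarrow> complex) \<Rightarrow> bool" where
  "tempered_distribution f \<longleftrightarrow>
     (\<forall>\<phi>\<in>schwartz. \<forall>\<psi>\<in>schwartz. f (\<lambda>t. \<phi> t + \<psi> t) = f \<phi> + f \<psi>) \<and>
     (\<forall>\<phi>\<in>schwartz. \<forall>c. f (\<lambda>t. c * \<phi> t) = c * f \<phi>) \<and>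
     (\<exists>N B. \<forall>\<phi>\<in>schwartz. norm (f \<phi>) \<le> B * (\<Sum>j\<le>N. \<Sum>k\<le>N. schwartz_seminorm j k \<phi>))"

definition tf_shift :: "real \<times> real \<Rightarrow> (real \<Rightarrow> complex) \<Rightarrow> real \<Rightarrow> complex" where
  "tf_shift z g t = exp (2 * of_real pi * \<i> * of_real (snd z * t)) * g (t - fst z)"

text \<open>Distributions act linearly, so that a function \<open>u\<close> corresponds to
  \<open>\<phi> \<mapsto> \<integral> u(t) \<phi>(t) dt\<close>; the sesquilinear pairing therefore conjugates the test function.\<close>

definition dual_pairing :: "((real \<Rightarrow> complex) \<Rightarrow> complex) \<Rightarrow> (real \<Rightarrow> complex) \<Rightarrow> complex" where
  "dual_pairing f \<phi> = f (\<lambda>t. cnj (\<phi> t))"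

definition stft ::
  "(real \<Rightarrow> complex) \<Rightarrow> ((real \<Rightarrow> complex) \<Rightarrow> complex) \<Rightarrow> real \<times> real \<Rightarrow> complex" where
  "stft g f z = dual_pairing f (tf_shift z g)"

lemma stft_function:
  "stft g (\<lambda>\<phi>. LINT t|lborel. u t * \<phi> t) (x, \<xi>) =
     (LINT t|lborel. u t * cnj (g (t - x)) * exp (- (2 * of_real pi * \<i> * of_real (\<xi> * t))))"
  by (simp add: stft_def dual_pairing_def tf_shift_def exp_cnj mult_ac)

definition hermite :: "nat \<Rightarrow> real \<Rightarrow> complex" where
  "hermite r t = of_real
     (2 powr (1/4) / sqrt (fact r) * (- 1 / (2 * sqrt pi)) ^ r * exp (pi * t\<^sup>2) *
      (deriv ^^ r) (\<lambda>s. exp (- 2 * pi * s\<^sup>2)) t)"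

definition modulation_space_1 :: "((real \<Rightarrow> complex) \<Rightarrow> complex) set" where
  "modulation_space_1 =
     {f. tempered_distribution f \<and> integrable lebesgue (stft (hermite 0) f)}"

definition L1_norm :: "(real \<times> real \<Rightarrow> complex) \<Rightarrow> ennreal" where
  "L1_norm F = (\<integral>\<^sup>+ z. ennreal (norm (F z)) \<partial>lebesgue)"

definition laguerre :: "nat \<Rightarrow> real \<Rightarrow> real" where
  "laguerre r x = (\<Sum>i=0..r. (- 1) ^ i * real (r choose i) * (x ^ i / fact i))"

definition max_density :: "(real \<times> real) set \<Rightarrow> real \<Rightarrow> ennreal" where
  "max_density \<Delta> R = (SUP z. emeasure lebesgue (\<Delta> \<inter> ball z R))"

definition sieve_const :: "nat \<Rightarrow> real \<Rightarrow> real" where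
  "sieve_const r R = (LINT t:{0..pi * R\<^sup>2}|lborel. (laguerre r t)\<^sup>2 * exp (- t))"

end

theory Submission
  imports Defs "HOL-Probability.Distributions" "HOL-Real_Asymp.Real_Asymp"
    "HOL-Complex_Analysis.Cauchy_Integral_Formula"
begin

text \<open>
  Write \<open>F = V\<^bsub>h\<^esub>f\<close> with \<open>h = h\<^sub>r\<close>. The whole theorem is a local reproducing formula: for each point
  \<open>z\<close> there is a kernel \<open>\<kappa>\<close> of modulus at most 1 with
  \<open>C\<^sub>r(R) F(z) = \<integral> \<kappa>(w) F(z + w) dw\<close>, the integral running over the disc of radius \<open>R\<close>
  (\<open>disc_integral_stft_hermite\<close>, \<open>norm_sieve_kernel_le\<close>). It bounds \<open>C\<^sub>r(R) |F(z)|\<close> by the integral of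
  \<open>|F|\<close> over the disc around \<open>z\<close>; integrating over \<open>z \<in> \<Delta>\<close> and exchanging the integrals leaves
  \<open>\<integral> |F(w)| |\<Delta> \<inter> (w + D\<^sub>R)| dw\<close>, which is at most \<open>\<rho>(\<Delta>, R)\<close> times the norm of \<open>F\<close>.

  The formula says that \<open>h\<^sub>r\<close> is an eigenfunction of time-frequency localisation to a disc, with
  eigenvalue \<open>C\<^sub>r(R)\<close>; the reason is rotational symmetry. With \<open>\<zeta> = x - i\<xi>\<close> and \<open>w = (x, \<xi>)\<close>,
  the conjugated time-frequency shift of \<open>h\<^sub>r\<close> by \<open>z + w\<close> is, up to a unimodular factor and
  \<open>e\<close> to the power \<open>-\<pi>|w|\<^sup>2/2\<close>, a combination of the functions \<open>\<phi>\<^sub>k(\<zeta>/2)\<close> with coefficients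
  proportional to powers of the conjugate of \<open>\<zeta>\<close> (\<open>cnj_tf_shift_hermite\<close>). Here \<open>\<phi>\<^sub>0(u)\<close> is a Gaussian
  depending holomorphically on \<open>u\<close> and \<open>\<phi>\<^sub>k\<close> is its \<open>k\<close>-th derivative in \<open>u\<close>. A tempered
  distribution commutes with these derivatives (\<open>tempered_gabor_has_field_derivative\<close>), so that
  \<open>\<Phi>\<^sub>k(u) = f(\<phi>\<^sub>k(u))\<close> is entire and \<open>\<Phi>\<^sub>k\<close> is the \<open>k\<close>-th derivative of \<open>\<Phi>\<^sub>0\<close>. Thus, up to
  the factors just named, \<open>F(z + w)\<close> is a polynomial of degree \<open>r\<close> in the conjugate
  of \<open>\<zeta>\<close> with entire coefficients. Integrating against a radial function over the disc removes every monomial that is not rotation invariant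
  (\<open>disc_integral_power_series\<close>), and from the \<open>k\<close>-th summand only the Taylor coefficient
  containing \<open>\<Phi>\<^sub>r(0)\<close> survives. But \<open>\<Phi>\<^sub>r(0)\<close> is \<open>F(z)\<close> up to normalisation, and the surviving
  numbers add up to the Laguerre polynomial of \<open>\<pi>|w|\<^sup>2\<close>.

  The kernel is bounded by 1 because \<open>|L\<^sub>r(x)|\<close> times \<open>e\<close> to the power \<open>-x/2\<close> is at most 1 for \<open>x \<ge> 0\<close>
  (\<open>abs_laguerre_le\<close>): this quantity is the modulus of the inner product of two translates of \<open>h\<^sub>r\<close>.
\<close>

section \<open>Hermite polynomials for the weight \<open>exp (- 2 \<pi> s\<^sup>2)\<close>\<close>

text \<open>The physicists' Hermite polynomials rescaled to the weight \<open>exp (- 2 \<pi> s\<^sup>2)\<close>, given by their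
  three-term recurrence. They are polymorphic because orthogonality is a statement over the reals,
  whereas holomorphic dependence on a parameter requires complex arguments. For \<open>n = 0\<close> the
  truncated \<open>n - 1\<close> is harmless, being multiplied by \<open>n\<close>.\<close>

fun herm :: "nat \<Rightarrow> 'a \<Rightarrow> 'a::{real_normed_field}" where
  "herm 0 s = 1"
| "herm (Suc n) s = of_real (4 * pi) * (s * herm n s - of_nat n * herm (n - 1) s)"

lemma herm_of_real: "herm n (of_real s) = of_real (herm n s)"
  by (induction n s rule: herm.induct) simp_all

lemma herm_has_field_derivative [derivative_intros]:
  assumes "(g has_field_derivative g') (at x within A)"
  shows "((\<lambda>x. herm n (g x)) has_field_derivative of_nat n * of_real (4 * pi) * herm (n - 1) (g x) * g')
           (at x within A)"
proof -
  have "(herm n has_field_derivative of_nat n * of_real (4 * pi) * herm (n - 1) s) (at s)" for s :: 'a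
  proof (induction n s rule: herm.induct)
    case (1 s)
    have "herm 0 = (\<lambda>s::'a. 1)" by (rule ext) simp
    then show ?case by simp
  next
    case (2 n s)
    have *: "herm (Suc n) = (\<lambda>s::'a. of_real (4 * pi) * (s * herm n s - of_nat n * herm (n - 1) s))"
      by (rule ext) simp
    show ?case
      unfolding * by (rule derivative_eq_intros 2 refl)+ (cases n; simp add: algebra_simps)
  qed
  from DERIV_chain[OF this assms] show ?thesis by (simp add: o_def)
qed

text \<open>Taylor's formula for a polynomial whose derivative is a multiple of its predecessor: both sides
  have the same derivative in \<open>b\<close>, by induction on the degree, and agree at \<open>b = 0\<close>.\<close>

lemma herm_add:
  fixes a b :: complex
  shows "herm r (a + b) = (\<Sum>k\<le>r. of_nat (r choose k) * (of_real (4 * pi) * b) ^ (r - k) * herm k a)"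
proof (induction r arbitrary: b)
  case (Suc r)
  define T where "T b = (\<Sum>k\<le>Suc r. of_nat (Suc r choose k) * (of_real (4 * pi) * b) ^ (Suc r - k) * herm k a)" for b
  have "((\<lambda>b. herm (Suc r) (a + b) - T b) has_field_derivative 0) (at b)" for b
  proof -
    have "(T has_field_derivative (\<Sum>k\<le>r. of_nat (Suc r choose k) * (of_nat (Suc r - k) *
             (of_real (4 * pi) * b) ^ (r - k) * of_real (4 * pi)) * herm k a)) (at b)"
      unfolding T_def sum.atMost_Suc
      by (rule derivative_eq_intros refl)+ (simp add: Suc_diff_le mult_ac)
    also have "(\<Sum>k\<le>r. of_nat (Suc r choose k) * (of_nat (Suc r - k) *
             (of_real (4 * pi) * b) ^ (r - k) * of_real (4 * pi)) * herm k a) =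
        of_nat (Suc r) * of_real (4 * pi) * herm r (a + b)"
      unfolding Suc.IH sum_distrib_left
    proof (rule sum.cong[OF refl], goal_cases)
      case (1 k)
      have "of_nat (Suc r choose k) * of_nat (Suc r - k) = (of_nat (Suc r) * of_nat (r choose k) :: complex)"
        using binomial_absorb_comp[of "Suc r" k] by (metis diff_Suc_1 mult.commute of_nat_mult)
      note eq = this
      have "of_nat (Suc r choose k) * (of_nat (Suc r - k) * (of_real (4 * pi) * b) ^ (r - k) * of_real (4 * pi)) * herm k a =
          (of_nat (Suc r choose k) * of_nat (Suc r - k)) * ((of_real (4 * pi) * b) ^ (r - k) * of_real (4 * pi) * herm k a)"
        by (simp only: mult_ac)
      then show ?case unfolding eq by (simp only: mult_ac)
    qed
    finally have "(T has_field_derivative of_nat (Suc r) * of_real (4 * pi) * herm r (a + b)) (at b)" .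
    moreover have "((\<lambda>b. herm (Suc r) (a + b)) has_field_derivative of_nat (Suc r) * of_real (4 * pi) * herm r (a + b)) (at b)"
      by (rule derivative_eq_intros refl)+ simp
    ultimately show ?thesis using DERIV_diff by fastforce
  qed
  then obtain c where c: "\<And>b. herm (Suc r) (a + b) - T b = c"
    using has_field_derivative_zero_constant[of UNIV "\<lambda>b. herm (Suc r) (a + b) - T b"] by auto
  have "T 0 = herm (Suc r) a"
    unfolding T_def sum.atMost_Suc by (simp add: Suc_diff_le)
  with c[of 0] have "c = 0" by simp
  with c[of b] show ?case by (simp add: T_def)
qed simp

lemma deriv_gaussian_iter:
  "(deriv ^^ r) (\<lambda>s::real. exp (- 2 * pi * s\<^sup>2)) = (\<lambda>s. (-1) ^ r * herm r s * exp (- 2 * pi * s\<^sup>2))"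
proof (induction r)
  case (Suc r)
  have "((\<lambda>s. (-1) ^ r * herm r s * exp (- 2 * pi * s\<^sup>2)) has_field_derivative
     (-1) ^ Suc r * herm (Suc r) s * exp (- 2 * pi * s\<^sup>2)) (at s)" for s :: real
    by (rule derivative_eq_intros refl)+ (simp add: algebra_simps)
  then show ?case
    using Suc by (auto intro!: ext DERIV_imp_deriv)
qed simp

definition hermite_norm :: "nat \<Rightarrow> real" where
  "hermite_norm r = 2 powr (1/4) / sqrt (fact r) * (1 / (2 * sqrt pi)) ^ r"

lemma hermite_eq: "hermite r t = of_real (hermite_norm r * herm r t * exp (- pi * t\<^sup>2))"
proof -
  have "exp (pi * t\<^sup>2) * exp (- 2 * pi * t\<^sup>2) = exp (- pi * t\<^sup>2)"
    by (simp flip: exp_add)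
  moreover have "(- 1 / (2 * sqrt pi)) ^ r * (-1) ^ r = (1 / (2 * sqrt pi)) ^ r"
    by (simp flip: power_mult_distrib)
  moreover have "2 powr (1/4) / sqrt (fact r) * (- 1 / (2 * sqrt pi)) ^ r * exp (pi * t\<^sup>2) *
      ((-1) ^ r * herm r t * exp (- 2 * pi * t\<^sup>2)) =
      2 powr (1/4) / sqrt (fact r) * ((- 1 / (2 * sqrt pi)) ^ r * (-1) ^ r) * herm r t *
      (exp (pi * t\<^sup>2) * exp (- 2 * pi * t\<^sup>2))"
    by (simp only: mult_ac)
  ultimately show ?thesis
    unfolding hermite_def deriv_gaussian_iter hermite_norm_def by (simp only:)
qed

text \<open>The power is absorbed into \<open>exp \<bar>t\<bar>\<close>, after which completing the square bounds the exponent.\<close>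

lemma abs_pow_gauss_bound: 
  assumes "c > 0"
  shows "\<exists>C. \<forall>t::real. \<bar>t\<bar> ^ j * exp (b * \<bar>t\<bar> - c * t\<^sup>2) \<le> C"
proof (intro exI allI)
  fix t :: real
  have "\<bar>t\<bar> ^ j / fact j \<le> exp \<bar>t\<bar>"
  proof -
    have "(\<lambda>n. \<bar>t\<bar> ^ n /\<^sub>R fact n) sums exp \<bar>t\<bar>" by (rule exp_converges)
    then have "sum (\<lambda>n. \<bar>t\<bar> ^ n /\<^sub>R fact n) {j} \<le> exp \<bar>t\<bar>"
      by (metis (no_types, lifting) abs_ge_zero divideR_right finite.emptyI finite_insert fact_gt_zero
          sum_le_suminf sums_summable sums_unique zero_le_power scaleR_nonneg_nonneg inverse_nonnegative_iff_nonnegative less_imp_le)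
    then show ?thesis by (simp add: field_simps)
  qed
  then have "\<bar>t\<bar> ^ j \<le> fact j * exp \<bar>t\<bar>" by (simp add: field_simps)
  then have "\<bar>t\<bar> ^ j * exp (b * \<bar>t\<bar> - c * t\<^sup>2) \<le> fact j * exp \<bar>t\<bar> * exp (b * \<bar>t\<bar> - c * t\<^sup>2)"
    by (rule mult_right_mono) simp
  also have "\<dots> = fact j * exp ((b + 1) * \<bar>t\<bar> - c * t\<^sup>2)"
    by (simp flip: exp_add add: algebra_simps)
  also have "(b + 1) * \<bar>t\<bar> - c * t\<^sup>2 = (b+1)\<^sup>2/(4*c) - c * (\<bar>t\<bar> - (b+1)/(2*c))\<^sup>2"
  proof -
    have "c * (\<bar>t\<bar> - (b+1)/(2*c))\<^sup>2 = c * t\<^sup>2 - (b+1) * \<bar>t\<bar> + (b+1)\<^sup>2/(4*c)"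
      using assms by (simp add: power2_diff power_divide field_simps power2_eq_square)
    then show ?thesis by simp
  qed
  also have "fact j * exp \<dots> \<le> fact j * exp ((b+1)\<^sup>2/(4*c))"
    using assms by simp
  finally show "\<bar>t\<bar> ^ j * exp (b * \<bar>t\<bar> - c * t\<^sup>2) \<le> fact j * exp ((b+1)\<^sup>2/(4*c))" .
qed

section \<open>Orthogonality and the bound for Laguerre polynomials\<close>

text \<open>Uniformity in \<open>u\<close> over a disc, an arbitrary power of \<open>t\<close> and the linear term in the exponent are
  what the Schwartz seminorms of the Gaussians \<open>\<phi>\<^sub>k(u)\<close> require; the free power \<open>j\<close> also makes the
  induction along the recurrence go through.\<close>

lemma herm_gauss_bound:
  assumes "c > 0"
  shows "\<exists>C. \<forall>t u. norm u \<le> \<rho> \<longrightarrow>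
           \<bar>t\<bar> ^ j * norm (herm m (of_real t - u :: complex)) * exp (b * \<bar>t\<bar> - c * t\<^sup>2) \<le> C"
proof (induction m arbitrary: j rule: less_induct)
  case (less m)
  show ?case
  proof (cases m)
    case 0
    with abs_pow_gauss_bound[OF assms, of j b] show ?thesis by auto
  next
    case (Suc n)
    obtain C1 where C1: "\<And>t u. norm u \<le> \<rho> \<Longrightarrow> \<bar>t\<bar> ^ Suc j * norm (herm n (of_real t - u :: complex)) * exp (b * \<bar>t\<bar> - c * t\<^sup>2) \<le> C1"
      using less.IH[of n "Suc j"] Suc by auto
    obtain C2 where C2: "\<And>t u. norm u \<le> \<rho> \<Longrightarrow> \<bar>t\<bar> ^ j * norm (herm n (of_real t - u :: complex)) * exp (b * \<bar>t\<bar> - c * t\<^sup>2) \<le> C2"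
      using less.IH[of n j] Suc by auto
    obtain C3 where C3: "\<And>t u. norm u \<le> \<rho> \<Longrightarrow> \<bar>t\<bar> ^ j * norm (herm (n - 1) (of_real t - u :: complex)) * exp (b * \<bar>t\<bar> - c * t\<^sup>2) \<le> C3"
      using less.IH[of "n - 1" j] Suc by (metis diff_le_self le_imp_less_Suc)
    have "\<bar>t\<bar> ^ j * norm (herm m (of_real t - u :: complex)) * exp (b * \<bar>t\<bar> - c * t\<^sup>2)
        \<le> 4 * pi * (C1 + \<rho> * C2 + n * C3)" if u: "norm u \<le> \<rho>" for t u
    proof -
      define E where "E = exp (b * \<bar>t\<bar> - c * t\<^sup>2)"
      define A where "A = norm (herm n (of_real t - u :: complex))"
      define B where "B = norm (herm (n-1) (of_real t - u :: complex))"
      have pos: "E \<ge> 0" "A \<ge> 0" "B \<ge> 0" "\<bar>t\<bar> ^ j \<ge> 0" "\<rho> \<ge> 0"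
        using order_trans[OF norm_ge_zero u] by (auto simp: E_def A_def B_def)
      have "norm (herm m (of_real t - u :: complex)) \<le> 4 * pi * ((\<bar>t\<bar> + \<rho>) * A + n * B)"
      proof -
        have "norm (of_real t - u) \<le> \<bar>t\<bar> + \<rho>"
          using norm_triangle_ineq4[of "of_real t" u] u by simp
        then have "norm ((of_real t - u) * herm n (of_real t - u) - of_nat n * herm (n-1) (of_real t - u))
            \<le> (\<bar>t\<bar> + \<rho>) * A + n * B"
          by (intro order_trans[OF norm_triangle_ineq4])
             (auto simp: norm_mult A_def B_def intro!: add_mono mult_right_mono)
        then show ?thesis by (simp add: Suc norm_mult)
      qed
      then have "\<bar>t\<bar> ^ j * norm (herm m (of_real t - u :: complex)) * E \<le> \<bar>t\<bar> ^ j * (4 * pi * ((\<bar>t\<bar> + \<rho>) * A + n * B)) * E"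
        using pos by (intro mult_right_mono mult_left_mono)
      also have "\<dots> = 4 * pi * ((\<bar>t\<bar> ^ Suc j * A * E) + \<rho> * (\<bar>t\<bar> ^ j * A * E) + n * (\<bar>t\<bar> ^ j * B * E))"
        by (simp add: algebra_simps)
      also have "\<dots> \<le> 4 * pi * (C1 + \<rho> * C2 + n * C3)"
        using C1[OF u] C2[OF u] C3[OF u] pos unfolding A_def B_def E_def
        by (intro mult_left_mono add_mono) auto
      finally show ?thesis unfolding E_def .
    qed
    then show ?thesis by blast
  qed
qed

lemma herm_gauss_bound_real:
  assumes "c > 0"
  shows "\<exists>C. \<forall>t::real. \<bar>herm m t\<bar> * exp (- c * t\<^sup>2) \<le> C"
proof -
  obtain C where C: "\<And>t u. norm u \<le> 0 \<Longrightarrow> \<bar>t\<bar> ^ 0 * norm (herm m (of_real t - u :: complex)) * exp (0 * \<bar>t\<bar> - c * t\<^sup>2) \<le> C"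
    using herm_gauss_bound[OF assms, of 0 0 m 0] by blast
  show ?thesis
    using C[of 0] by (auto simp: herm_of_real)
qed

lemma integrable_gaussian: "integrable lborel (\<lambda>t::real. exp (- pi * t\<^sup>2))"
proof -
  have "normal_density 0 (1 / sqrt (2 * pi)) = (\<lambda>t. exp (- pi * t\<^sup>2))"
    by (auto simp: normal_density_def power_divide)
  with integrable_normal_density[of "1 / sqrt (2 * pi)" 0] show ?thesis by simp
qed

lemma continuous_on_herm [continuous_intros]:
  "continuous_on A f \<Longrightarrow> continuous_on A (\<lambda>x. herm n (f x))"
proof -
  assume f: "continuous_on A f"
  have "continuous_on UNIV (herm n :: 'b \<Rightarrow> 'b)"
    by (rule continuous_at_imp_continuous_on)
       (auto intro!: DERIV_isCont herm_has_field_derivative[OF DERIV_ident])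
  from continuous_on_compose2[OF this f] show ?thesis by simp
qed

lemma herm_prod_gauss_bound:
  "\<exists>C. \<forall>t::real. \<bar>herm m t * herm n t * exp (- 2 * pi * t\<^sup>2)\<bar> \<le> C * exp (- pi * t\<^sup>2)"
proof -
  obtain A where A: "\<And>t::real. \<bar>herm m t\<bar> * exp (- (pi/2) * t\<^sup>2) \<le> A"
    using herm_gauss_bound_real[of "pi/2" m] by auto
  obtain B where B: "\<And>t::real. \<bar>herm n t\<bar> * exp (- (pi/2) * t\<^sup>2) \<le> B"
    using herm_gauss_bound_real[of "pi/2" n] by auto
  have "\<bar>herm m t * herm n t * exp (- 2 * pi * t\<^sup>2)\<bar> \<le> (A * B) * exp (- pi * t\<^sup>2)" for t :: real
  proof -
    have "exp (- 2 * pi * t\<^sup>2) = exp (- (pi/2) * t\<^sup>2) * exp (- (pi/2) * t\<^sup>2) * exp (- pi * t\<^sup>2)"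
      by (simp flip: exp_add add: algebra_simps)
    then have "\<bar>herm m t * herm n t * exp (- 2 * pi * t\<^sup>2)\<bar> =
       (\<bar>herm m t\<bar> * exp (- (pi/2) * t\<^sup>2)) * (\<bar>herm n t\<bar> * exp (- (pi/2) * t\<^sup>2)) * exp (- pi * t\<^sup>2)"
      by (simp add: abs_mult)
    also have "\<dots> \<le> (A * B) * exp (- pi * t\<^sup>2)"
      using A[of t] B[of t] order_trans[OF _ A[of t]]
      by (intro mult_right_mono mult_mono) auto
    finally show ?thesis .
  qed
  then show ?thesis by blast
qed

lemma integrable_herm_prod:
  "integrable lborel (\<lambda>t::real. herm m t * herm n t * exp (- 2 * pi * t\<^sup>2))"
proof -
  obtain C where C: "\<And>t::real. \<bar>herm m t * herm n t * exp (- 2 * pi * t\<^sup>2)\<bar> \<le> C * exp (- pi * t\<^sup>2)"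
    using herm_prod_gauss_bound by blast
  have "integrable lborel (\<lambda>t::real. C * exp (- pi * t\<^sup>2))"
    using integrable_gaussian by simp
  then show ?thesis
    by (rule Bochner_Integration.integrable_bound)
       (use C in \<open>auto intro!: borel_measurable_continuous_onI continuous_intros simp: order_trans[OF _ abs_ge_self]\<close>)
qed

lemma tendsto_gauss_at_infinity: "((\<lambda>t::real. exp (- pi * t\<^sup>2)) \<longlongrightarrow> 0) at_top"
  "((\<lambda>t::real. exp (- pi * t\<^sup>2)) \<longlongrightarrow> 0) at_bot"
  by real_asymp+

text \<open>Integration by parts: the derivative of \<open>herm m t * herm n t * exp (- 2 \<pi> t\<^sup>2)\<close> is the difference of
  the right-hand integrand, multiplied by \<open>4 \<pi> m\<close>, and the left-hand one,
  because the recurrence expresses \<open>herm (Suc n)\<close> times the weight as minus the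
  derivative of \<open>herm n\<close> times the weight.\<close>

lemma herm_inner_Suc:
  "(LINT t|lborel. herm m t * herm (Suc n) t * exp (- 2 * pi * t\<^sup>2)) =
     4 * pi * real m * (LINT t|lborel. herm (m - 1) t * herm n t * exp (- 2 * pi * t\<^sup>2))"
proof -
  obtain C where C: "\<And>t::real. \<bar>herm m t * herm n t * exp (- 2 * pi * t\<^sup>2)\<bar> \<le> C * exp (- pi * t\<^sup>2)"
    using herm_prod_gauss_bound by blast
  define F where "F t = herm m t * herm n t * exp (- 2 * pi * t\<^sup>2)" for t :: real
  define f where "f t = 4 * pi * real m * (herm (m - 1) t * herm n t * exp (- 2 * pi * t\<^sup>2))
      - herm m t * herm (Suc n) t * exp (- 2 * pi * t\<^sup>2)" for t :: real
  have int: "integrable lborel f"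
    unfolding f_def using integrable_herm_prod[of m "Suc n"] integrable_herm_prod[of "m-1" n]
    by (intro Bochner_Integration.integrable_diff integrable_mult_right) 
  have FC: "norm (F t) \<le> C * exp (- pi * t\<^sup>2)" for t
    using C[of t] unfolding F_def real_norm_def .
  have lim: "(F \<longlongrightarrow> 0) at_top" "(F \<longlongrightarrow> 0) at_bot"
    using tendsto_mult_right_zero[OF tendsto_gauss_at_infinity(1), of C]
      tendsto_mult_right_zero[OF tendsto_gauss_at_infinity(2), of C]
    by (auto intro!: Lim_null_comparison[OF always_eventually, of F] FC)
  have "(LBINT t=-\<infinity>..\<infinity>. f t) = 0 - 0"
  proof (rule interval_integral_FTC_integrable[where F = F])
    fix t :: real
    have "(F has_real_derivative f t) (at t)"
      unfolding F_def f_def by (rule derivative_eq_intros refl)+ (simp add: algebra_simps)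
    then show "(F has_vector_derivative f t) (at t)"
      by (simp add: has_real_derivative_iff_has_vector_derivative)
    have "continuous_on UNIV f" unfolding f_def by (intro continuous_intros)
    then show "isCont f t" by (simp add: continuous_on_eq_continuous_at)
  next
    show "set_integrable lborel (einterval (-\<infinity>) \<infinity>) f"
      using int by (simp add: set_integrable_def)
    show "((F \<circ> real_of_ereal) \<longlongrightarrow> 0) (at_right (-\<infinity>))" "((F \<circ> real_of_ereal) \<longlongrightarrow> 0) (at_left \<infinity>)"
      using lim by (simp_all add: ereal_tendsto_simps)
  qed simp
  then have "integral\<^sup>L lborel f = 0"
    by (simp add: interval_lebesgue_integral_def set_lebesgue_integral_def)
  then show ?thesis
    unfolding f_def using integrable_herm_prod[of m "Suc n"] integrable_herm_prod[of "m-1" n]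
    by (subst (asm) Bochner_Integration.integral_diff) auto
qed

lemma herm_orthogonal:
  "(LINT t|lborel. herm m t * herm n t * exp (- 2 * pi * t\<^sup>2)) =
     (if m = n then fact n * (4 * pi) ^ n * (LINT t|lborel. exp (- 2 * pi * t\<^sup>2)) else 0)"
proof (induction n arbitrary: m)
  case 0
  show ?case
  proof (cases m)
    case (Suc m')
    have "(LINT t|lborel. herm m t * herm 0 t * exp (- 2 * pi * t\<^sup>2)) =
        (LINT t|lborel. herm 0 t * herm m t * exp (- 2 * pi * t\<^sup>2))"
      by (simp only: mult.commute)
    also have "\<dots> = 0" unfolding Suc herm_inner_Suc by simp
    finally show ?thesis using Suc by simp
  qed simp
next
  case (Suc n)
  show ?case
    unfolding herm_inner_Suc Suc.IH by (cases m) (auto simp: algebra_simps)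
qed

lemma laguerre_alt: "laguerre r x = (\<Sum>k\<le>r. real (r choose k) * (- x) ^ (r - k) / fact (r - k))"
proof -
  have "laguerre r x = (\<Sum>i\<in>{..r}. real (r choose i) * (- x) ^ i / fact i)"
    unfolding laguerre_def atMost_atLeast0
    by (intro sum.cong) (auto simp: power_minus[of x])
  also have "\<dots> = (\<Sum>k\<le>r. real (r choose (r - k)) * (- x) ^ (r - k) / fact (r - k))"
    by (rule sum.reindex_bij_witness[of _ "\<lambda>k. r - k" "\<lambda>k. r - k"]) auto
  also have "\<dots> = (\<Sum>k\<le>r. real (r choose k) * (- x) ^ (r - k) / fact (r - k))"
    by (intro sum.cong refl) (simp only: atMost_iff binomial_symmetric[symmetric])
  finally show ?thesis .
qed

lemma herm_add_real:
  fixes a b :: real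
  shows "herm r (a + b) = (\<Sum>k\<le>r. real (r choose k) * (4 * pi * b) ^ (r - k) * herm k a)"
proof -
  have "complex_of_real (herm r (a + b)) = of_real (\<Sum>k\<le>r. real (r choose k) * (4 * pi * b) ^ (r - k) * herm k a)"
    using herm_add[of r "of_real a" "of_real b"] by (simp flip: herm_of_real)
  then show ?thesis by (simp only: of_real_eq_iff)
qed

text \<open>Expanding both translates by \<open>herm_add_real\<close> and using orthogonality leaves the explicit sum that
  defines the Laguerre polynomial.\<close>

lemma herm_shift_inner:
  "(LINT t|lborel. herm r (t - y) * herm r (t + y) * exp (- 2 * pi * t\<^sup>2)) =
     fact r * (4 * pi) ^ r * (LINT t|lborel. exp (- 2 * pi * t\<^sup>2)) * laguerre r (4 * pi * y\<^sup>2)"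
proof -
  define M where "M = (LINT t|lborel. exp (- 2 * pi * t\<^sup>2))"
  define c where "c y k = real (r choose k) * (4 * pi * y) ^ (r - k)" for y k
  have *: "herm r (t - y) * herm r (t + y) * exp (- 2 * pi * t\<^sup>2) =
     (\<Sum>k\<le>r. \<Sum>l\<le>r. c (-y) k * c y l * (herm k t * herm l t * exp (- 2 * pi * t\<^sup>2)))" for t
  proof -
    have "herm r (t + y) = (\<Sum>l\<le>r. c y l * herm l t)" "herm r (t - y) = (\<Sum>k\<le>r. c (-y) k * herm k t)"
      using herm_add_real[of r t y] herm_add_real[of r t "-y"] by (simp_all add: c_def)
    then have "herm r (t - y) * herm r (t + y) = (\<Sum>k\<le>r. \<Sum>l\<le>r. c (-y) k * herm k t * (c y l * herm l t))"
      by (simp only: sum_product)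
    then show ?thesis by (simp add: sum_distrib_right sum_distrib_left mult_ac)
  qed
  have "(LINT t|lborel. herm r (t - y) * herm r (t + y) * exp (- 2 * pi * t\<^sup>2)) =
     (\<Sum>k\<le>r. \<Sum>l\<le>r. c (-y) k * c y l * (LINT t|lborel. herm k t * herm l t * exp (- 2 * pi * t\<^sup>2)))"
    unfolding *
    by (subst Bochner_Integration.integral_sum; (intro Bochner_Integration.integrable_sum integrable_mult_right integrable_herm_prod)?)
       (intro sum.cong refl, subst Bochner_Integration.integral_sum;
         (intro integrable_mult_right integrable_herm_prod)?; simp)
  also have "\<dots> = (\<Sum>k\<le>r. \<Sum>l\<le>r. if k = l then c (-y) k * c y k * (fact k * (4 * pi) ^ k * M) else 0)"
    unfolding herm_orthogonal M_def by (intro sum.cong) auto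
  also have "\<dots> = (\<Sum>k\<le>r. c (-y) k * c y k * (fact k * (4 * pi) ^ k * M))"
    by simp
  also have "\<dots> = (\<Sum>k\<le>r. fact r * (4 * pi) ^ r * M * (real (r choose k) * (- (4 * pi * y\<^sup>2)) ^ (r - k) / fact (r - k)))"
  proof (rule sum.cong[OF refl])
    fix k assume "k \<in> {..r}"
    then have k: "k \<le> r" by simp
    have 1: "real (r choose k) * fact k = fact r / fact (r - k)"
      using binomial_fact[OF k, where 'a = real] by simp
    have 2: "(4 * pi * - y) ^ (r - k) * (4 * pi * y) ^ (r - k) * (4 * pi) ^ k = (4 * pi) ^ r * (- (4 * pi * y\<^sup>2)) ^ (r - k)"
    proof -
      have "(4 * pi * - y) ^ (r - k) * (4 * pi * y) ^ (r - k) = (4 * pi) ^ (r - k) * (- (4 * pi * y\<^sup>2)) ^ (r - k)"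
        unfolding power_mult_distrib[symmetric] by (rule arg_cong[of _ _ "\<lambda>x. x ^ (r - k)"]) (simp add: power2_eq_square)
      moreover have "(4 * pi) ^ r = (4 * pi) ^ (r - k) * (4 * pi) ^ k"
        using k by (simp only: power_add[symmetric] le_add_diff_inverse2)
      ultimately show ?thesis by simp
    qed
    have "c (-y) k * c y k * (fact k * (4 * pi) ^ k * M) =
        real (r choose k) * (real (r choose k) * fact k) * ((4 * pi * - y) ^ (r - k) * (4 * pi * y) ^ (r - k) * (4 * pi) ^ k) * M"
      unfolding c_def by (simp only: mult_ac)
    also have "\<dots> = fact r * (4 * pi) ^ r * M * (real (r choose k) * (- (4 * pi * y\<^sup>2)) ^ (r - k) / fact (r - k))"
      unfolding 1 2 by (simp only: mult_ac times_divide_eq_right times_divide_eq_left)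
    finally show "c (-y) k * c y k * (fact k * (4 * pi) ^ k * M) = fact r * (4 * pi) ^ r * M * (real (r choose k) * (- (4 * pi * y\<^sup>2)) ^ (r - k) / fact (r - k))" .
  qed
  finally show ?thesis
    unfolding laguerre_alt M_def sum_distrib_left .
qed

text \<open>Up to the positive factor \<open>N\<close>, the squared norm of \<open>G t = herm r t * exp (- \<pi> t\<^sup>2)\<close>, the left-hand
  side is the modulus of the inner product of the translates of \<open>G\<close> by \<open>y\<close> and \<open>-y\<close>, where
  \<open>x = 4 \<pi> y\<^sup>2\<close>. The estimate \<open>2ab \<le> a\<^sup>2 + b\<^sup>2\<close> bounds that inner product by \<open>N\<close>. The value of the
  Gaussian integral cancels, so only its positivity matters.\<close>

lemma abs_laguerre_le:
  assumes "x \<ge> 0"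
  shows "\<bar>laguerre r x\<bar> * exp (- x / 2) \<le> 1"
proof -
  define y where "y = sqrt (x / (4 * pi))"
  have y: "4 * pi * y\<^sup>2 = x" using assms by (simp add: y_def)
  define M where "M = (LINT t|lborel. exp (- 2 * pi * t\<^sup>2))"
  define N where "N = fact r * (4 * pi) ^ r * M"
  define G where "G t = herm r t * exp (- pi * t\<^sup>2)" for t
  have G2: "(G t)\<^sup>2 = herm r t * herm r t * exp (- 2 * pi * t\<^sup>2)" for t
    unfolding G_def by (simp add: power2_eq_square mult_exp_exp)
  have int: "integrable lborel (\<lambda>t. (G t)\<^sup>2)"
    unfolding G2 by (rule integrable_herm_prod)
  have N: "(LINT t|lborel. (G t)\<^sup>2) = N"
    unfolding G2 herm_orthogonal N_def M_def by simp
  have "M > 0"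
  proof -
    have int': "integrable lborel (\<lambda>t::real. exp (- 2 * pi * t\<^sup>2))"
      using integrable_herm_prod[of 0 0] by simp
    have "M \<noteq> 0"
    proof
      assume "M = 0"
      then have "AE t in lborel. exp (- 2 * pi * (t::real)\<^sup>2) = 0"
        unfolding M_def by (subst (asm) integral_nonneg_eq_0_iff_AE[OF int']) auto
      then have "AE t::real in lborel. False" by simp
      then have "emeasure lborel (UNIV :: real set) = 0"
        using AE_iff_measurable[of UNIV lborel "\<lambda>_::real. False"] by auto
      then show False by simp
    qed
    moreover have "M \<ge> 0" unfolding M_def by (rule Bochner_Integration.integral_nonneg) simp
    ultimately show ?thesis by simp
  qed
  then have "N > 0" by (simp add: N_def)
  have shift: "integrable lborel (\<lambda>t. (G (s + t))\<^sup>2)" "(LINT t|lborel. (G (s + t))\<^sup>2) = N" for s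
    using lborel_integrable_real_affine[OF int, of 1 s] lborel_integral_real_affine[of 1 "\<lambda>t. (G t)\<^sup>2" s] N
    by simp_all
  have prod: "G (- y + t) * G (y + t) = exp (- x / 2) * (herm r (t - y) * herm r (t + y) * exp (- 2 * pi * t\<^sup>2))" for t
  proof -
    have "- pi * (t - y)\<^sup>2 - pi * (t + y)\<^sup>2 = - x / 2 - 2 * pi * t\<^sup>2"
      unfolding y[symmetric] by (simp add: power2_eq_square algebra_simps)
    then have "exp (- pi * (t - y)\<^sup>2) * exp (- pi * (t + y)\<^sup>2) = exp (- x / 2) * exp (- 2 * pi * t\<^sup>2)"
      by (simp add: mult_exp_exp)
    moreover have "G (- y + t) * G (y + t) = herm r (t - y) * herm r (t + y) * (exp (- pi * (t - y)\<^sup>2) * exp (- pi * (t + y)\<^sup>2))"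
      unfolding G_def by (simp add: mult_ac add.commute)
    ultimately show ?thesis by (simp only: mult_ac)
  qed
  have "exp (- x / 2) * (N * laguerre r x) = (LINT t|lborel. G (- y + t) * G (y + t))"
    unfolding prod using herm_shift_inner[of r y] by (simp add: y N_def M_def)
  also have "\<bar>\<dots>\<bar> \<le> (LINT t|lborel. ((G (- y + t))\<^sup>2 + (G (y + t))\<^sup>2) / 2)"
  proof (rule integral_abs_bound_integral)
    show "integrable lborel (\<lambda>t. ((G (- y + t))\<^sup>2 + (G (y + t))\<^sup>2) / 2)"
      by (intro Bochner_Integration.integrable_add integrable_divide shift)
    show am: "\<bar>G (- y + t) * G (y + t)\<bar> \<le> ((G (- y + t))\<^sup>2 + (G (y + t))\<^sup>2) / 2" for t
      using sum_squares_bound[of "\<bar>G (- y + t)\<bar>" "\<bar>G (y + t)\<bar>"] by (simp add: abs_mult)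
    show "integrable lborel (\<lambda>t. G (- y + t) * G (y + t))"
    proof (rule Bochner_Integration.integrable_bound[OF \<open>integrable lborel (\<lambda>t. ((G (- y + t))\<^sup>2 + (G (y + t))\<^sup>2) / 2)\<close>])
      show "(\<lambda>t. G (- y + t) * G (y + t)) \<in> borel_measurable lborel"
        unfolding G_def by (auto intro!: borel_measurable_continuous_onI continuous_intros)
    qed (use am in \<open>auto simp: order_trans[OF _ abs_ge_self]\<close>)
  qed
  also have "\<dots> = ((LINT t|lborel. (G (- y + t))\<^sup>2) + (LINT t|lborel. (G (y + t))\<^sup>2)) / 2"
    by (subst integral_divide_zero, subst Bochner_Integration.integral_add) (intro shift refl)+
  also have "\<dots> = N" unfolding shift by simp
  finally have "N * (exp (- x / 2) * \<bar>laguerre r x\<bar>) \<le> N * 1"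
    using \<open>N > 0\<close> by (simp add: abs_mult mult_ac)
  then show ?thesis
    using \<open>N > 0\<close> by (simp add: mult.commute)
qed

section \<open>Linearity on the Schwartz space\<close>

lemma schwartz_iter_deriv:
  assumes "\<phi> \<in> schwartz"
  shows "(iter_deriv k \<phi> has_vector_derivative iter_deriv (Suc k) \<phi> t) (at t)"
  using assms by (auto simp: schwartz_def iter_deriv_def vector_derivative_works[symmetric])

lemma iter_deriv_linear:
  assumes "\<phi> \<in> schwartz" "\<psi> \<in> schwartz"
  shows "iter_deriv k (\<lambda>t. a * \<phi> t + b * \<psi> t) = (\<lambda>t. a * iter_deriv k \<phi> t + b * iter_deriv k \<psi> t)"
proof (induction k)
  case 0
  then show ?case by (simp add: iter_deriv_def)
next
  case (Suc k)
  have "((\<lambda>t. a * iter_deriv k \<phi> t + b * iter_deriv k \<psi> t) has_vector_derivative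
          a * iter_deriv (Suc k) \<phi> t + b * iter_deriv (Suc k) \<psi> t) (at t)" for t
    by (intro has_vector_derivative_add has_vector_derivative_mult_right schwartz_iter_deriv assms)
  then have "vector_derivative (iter_deriv k (\<lambda>t. a * \<phi> t + b * \<psi> t)) (at t) =
          a * iter_deriv (Suc k) \<phi> t + b * iter_deriv (Suc k) \<psi> t" for t
    unfolding Suc by (rule vector_derivative_at)
  then show ?case by (auto simp: iter_deriv_def)
qed

lemma schwartz_linear:
  assumes "\<phi> \<in> schwartz" "\<psi> \<in> schwartz"
  shows "(\<lambda>t. a * \<phi> t + b * \<psi> t) \<in> schwartz"
  unfolding schwartz_def
proof (intro CollectI conjI allI)
  fix k t
  show "iter_deriv k (\<lambda>t. a * \<phi> t + b * \<psi> t) differentiable at t"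
    unfolding iter_deriv_linear[OF assms] differentiable_def
    using has_vector_derivative_add[OF
        has_vector_derivative_mult_right[OF schwartz_iter_deriv[OF assms(1)]]
        has_vector_derivative_mult_right[OF schwartz_iter_deriv[OF assms(2)]]]
    unfolding has_vector_derivative_def by blast
next
  fix j k
  from assms obtain A B where
    A: "\<And>t. norm (t ^ j *\<^sub>R iter_deriv k \<phi> t) \<le> A" and
    B: "\<And>t. norm (t ^ j *\<^sub>R iter_deriv k \<psi> t) \<le> B"
    by (fastforce simp: schwartz_def bounded_iff)
  have "norm (t ^ j *\<^sub>R (a * iter_deriv k \<phi> t + b * iter_deriv k \<psi> t)) \<le> norm a * A + norm b * B" for t
  proof -
    have "t ^ j *\<^sub>R (a * iter_deriv k \<phi> t + b * iter_deriv k \<psi> t) =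
        a * (t ^ j *\<^sub>R iter_deriv k \<phi> t) + b * (t ^ j *\<^sub>R iter_deriv k \<psi> t)"
      by (simp add: scaleR_add_right)
    also have "norm \<dots> \<le> norm a * A + norm b * B"
      by (intro order_trans[OF norm_triangle_ineq] add_mono)
         (simp_all only: norm_mult mult_left_mono[OF A] mult_left_mono[OF B] norm_ge_zero)
    finally show ?thesis .
  qed
  then show "bounded (range (\<lambda>t. t ^ j *\<^sub>R iter_deriv k (\<lambda>t. a * \<phi> t + b * \<psi> t) t))"
    unfolding iter_deriv_linear[OF assms] by (auto simp: bounded_iff)
qed

lemma schwartz_scale: "\<phi> \<in> schwartz \<Longrightarrow> (\<lambda>t. a * \<phi> t) \<in> schwartz"
  using schwartz_linear[of \<phi> \<phi> a 0] by simp

lemma tempered_linear: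
  assumes "tempered_distribution f" "\<phi> \<in> schwartz" "\<psi> \<in> schwartz"
  shows "f (\<lambda>t. a * \<phi> t + b * \<psi> t) = a * f \<phi> + b * f \<psi>"
  using assms schwartz_scale[of \<phi> a] schwartz_scale[of \<psi> b]
  unfolding tempered_distribution_def by metis

lemma tempered_sum:
  assumes "tempered_distribution f" "finite A" "A \<noteq> {}" "\<And>k. k \<in> A \<Longrightarrow> \<phi> k \<in> schwartz"
  shows "(\<lambda>t. \<Sum>k\<in>A. c k * \<phi> k t) \<in> schwartz \<and> f (\<lambda>t. \<Sum>k\<in>A. c k * \<phi> k t) = (\<Sum>k\<in>A. c k * f (\<phi> k))"
  using assms(2-4)
proof (induction A rule: finite_ne_induct)
  case (singleton k)
  then show ?case
    using assms(1) schwartz_scale[of "\<phi> k" "c k"] by (auto simp: tempered_distribution_def)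
next
  case (insert k A)
  then show ?case
    using tempered_linear[OF assms(1), of "\<phi> k" "\<lambda>t. \<Sum>k\<in>A. c k * \<phi> k t" "c k" 1]
          schwartz_linear[of "\<phi> k" "\<lambda>t. \<Sum>k\<in>A. c k * \<phi> k t" "c k" 1]
    by simp
qed

section \<open>Tempered distributions on a holomorphic family of Gaussians\<close>

text \<open>The functions \<open>\<phi>\<^sub>m(u)\<close>: the \<open>m\<close>-th derivative in the complex parameter \<open>u\<close> of the Gaussian
  \<open>exp (- \<pi> (t - x0)\<^sup>2 + 4 \<pi> (t - x0) u - 2 \<pi> u\<^sup>2)\<close>, which is the generating function of the Hermite
  functions centred at \<open>x0\<close>, modulated by \<open>\<xi>0\<close>. Carrying the centre \<open>(x0, \<xi>0)\<close> along takes care of the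
  base point of the disc, without having to translate the distribution.\<close>

definition gabor :: "real \<Rightarrow> real \<Rightarrow> nat \<Rightarrow> complex \<Rightarrow> real \<Rightarrow> complex" where
  "gabor x0 \<xi>0 m u t = herm m (of_real (t - x0) - u) *
     exp (- (2 * of_real pi * \<i> * of_real (\<xi>0 * t)) - of_real pi * (of_real (t - x0))\<^sup>2
       + 4 * of_real pi * of_real (t - x0) * u - 2 * of_real pi * u\<^sup>2)"

text \<open>The \<open>k\<close>-th derivative in \<open>t\<close> of \<^term>\<open>gabor x0 \<xi>0 m u\<close>. The ladder relations of the Hermite functions
  express one derivative in \<open>t\<close> through \<open>\<phi>\<close>'s with neighbouring indices and the same \<open>u\<close>. Iterating
  them by recursion keeps all derivatives inside one family, on which differentiation
  in \<open>u\<close> is again the index shift \<open>m \<mapsto> Suc m\<close>.\<close>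

primrec gabor_deriv :: "real \<Rightarrow> real \<Rightarrow> nat \<Rightarrow> nat \<Rightarrow> complex \<Rightarrow> real \<Rightarrow> complex" where
  "gabor_deriv x0 \<xi>0 0 m u t = gabor x0 \<xi>0 m u t"
| "gabor_deriv x0 \<xi>0 (Suc k) m u t =
     2 * of_real pi * of_nat m * gabor_deriv x0 \<xi>0 k (m - 1) u t
     - gabor_deriv x0 \<xi>0 k (Suc m) u t / 2
     + 2 * of_real pi * (u - \<i> * of_real \<xi>0) * gabor_deriv x0 \<xi>0 k m u t"

lemma gabor_deriv_has_vector_derivative:
  "(gabor_deriv x0 \<xi>0 k m u has_vector_derivative gabor_deriv x0 \<xi>0 (Suc k) m u t) (at t)"
proof (induction k arbitrary: m)
  case 0
  define E where "E v = exp (- (2 * of_real pi * \<i> * of_real \<xi>0 * v) - of_real pi * (v - of_real x0)\<^sup>2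
       + 4 * of_real pi * (v - of_real x0) * u - 2 * of_real pi * u\<^sup>2)" for v :: complex
  have gab: "gabor x0 \<xi>0 n u s = herm n (of_real s - of_real x0 - u) * E (of_real s)" for n s
    by (simp add: gabor_def E_def mult_ac)
  have "((\<lambda>v. herm m (v - of_real x0 - u) * E v) has_field_derivative
     (2 * of_real pi * of_nat m * herm (m - 1) (v - of_real x0 - u)
     - herm (Suc m) (v - of_real x0 - u) / 2
     + 2 * of_real pi * (u - \<i> * of_real \<xi>0) * herm m (v - of_real x0 - u)) * E v) (at v)" for v
    unfolding E_def
    by (rule derivative_eq_intros refl)+ (simp add: field_simps)
  note has_vector_derivative_real_field[OF this[of "of_real t"], of UNIV]
  moreover have "gabor_deriv x0 \<xi>0 0 m u = (\<lambda>s. herm m (of_real s - of_real x0 - u) * E (of_real s))"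
    by (rule ext) (simp add: gab)
  moreover have "gabor_deriv x0 \<xi>0 (Suc 0) m u t = (2 * of_real pi * of_nat m * herm (m - 1) (of_real t - of_real x0 - u)
     - herm (Suc m) (of_real t - of_real x0 - u) / 2
     + 2 * of_real pi * (u - \<i> * of_real \<xi>0) * herm m (of_real t - of_real x0 - u)) * E (of_real t)"
    by (simp add: gab ring_distribs del: herm.simps)
  ultimately show ?case by (simp only:)
next
  case (Suc k)
  have *: "gabor_deriv x0 \<xi>0 (Suc k) m u = (\<lambda>t. 2 * of_real pi * of_nat m * gabor_deriv x0 \<xi>0 k (m - 1) u t
     - (1/2) * gabor_deriv x0 \<xi>0 k (Suc m) u t
     + 2 * of_real pi * (u - \<i> * of_real \<xi>0) * gabor_deriv x0 \<xi>0 k m u t)"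
    by (rule ext) simp
  have **: "gabor_deriv x0 \<xi>0 (Suc (Suc k)) m u t = 2 * of_real pi * of_nat m * gabor_deriv x0 \<xi>0 (Suc k) (m - 1) u t
     - (1/2) * gabor_deriv x0 \<xi>0 (Suc k) (Suc m) u t
     + 2 * of_real pi * (u - \<i> * of_real \<xi>0) * gabor_deriv x0 \<xi>0 (Suc k) m u t"
    by (simp only: gabor_deriv.simps(2)[of _ _ "Suc k"]) simp
  show ?case
    by (subst *, subst **, intro has_vector_derivative_add has_vector_derivative_diff has_vector_derivative_mult_right Suc)
qed

lemma gabor_deriv_has_field_derivative:
  "((\<lambda>u. gabor_deriv x0 \<xi>0 k m u t) has_field_derivative gabor_deriv x0 \<xi>0 k (Suc m) u t) (at u)"
proof (induction k arbitrary: m)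
  case 0
  show ?case
    unfolding gabor_deriv.simps gabor_def
    by (rule derivative_eq_intros refl)+ (simp add: algebra_simps)
next
  case (Suc k)
  have "((\<lambda>u. 2 * of_real pi * of_nat m * gabor_deriv x0 \<xi>0 k (m - 1) u t
     - (1/2) * gabor_deriv x0 \<xi>0 k (Suc m) u t
     + (2 * of_real pi * (u - \<i> * of_real \<xi>0)) * gabor_deriv x0 \<xi>0 k m u t) has_field_derivative
     2 * of_real pi * of_nat m * gabor_deriv x0 \<xi>0 k (Suc (m - 1)) u t
     - (1/2) * gabor_deriv x0 \<xi>0 k (Suc (Suc m)) u t
     + (2 * of_real pi * 1 * gabor_deriv x0 \<xi>0 k m u t + gabor_deriv x0 \<xi>0 k (Suc m) u t * (2 * of_real pi * (u - \<i> * of_real \<xi>0)))) (at u)"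
    by (intro DERIV_add DERIV_diff DERIV_mult DERIV_cmult Suc) (auto intro!: derivative_eq_intros)
  then show ?case
    unfolding gabor_deriv.simps by (rule back_subst) (cases m; simp add: algebra_simps)
qed

lemma gabor_deriv_bound:
  "\<exists>C. \<forall>t u. norm u \<le> \<rho> \<longrightarrow> norm (t ^ j *\<^sub>R gabor_deriv x0 \<xi>0 k m u t) \<le> C"
proof (induction k arbitrary: m)
  case 0
  define b where "b = 2 * pi * \<bar>x0\<bar> + 4 * pi * \<rho>"
  define d where "d = 4 * pi * \<bar>x0\<bar> * \<rho> + 2 * pi * \<rho>\<^sup>2"
  obtain C where C: "\<And>t u. norm u \<le> \<rho> + \<bar>x0\<bar> \<Longrightarrow>
       \<bar>t\<bar> ^ j * norm (herm m (of_real t - u :: complex)) * exp (b * \<bar>t\<bar> - pi * t\<^sup>2) \<le> C"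
    using herm_gauss_bound[OF pi_gt_zero, of "\<rho> + \<bar>x0\<bar>" j m b] by blast
  have "norm (t ^ j *\<^sub>R gabor_deriv x0 \<xi>0 0 m u t) \<le> C * exp d" if u: "norm u \<le> \<rho>" for t u
  proof -
    have herm: "herm m (of_real (t - x0) - u) = herm m (of_real t - (u + of_real x0))"
      by (simp add: algebra_simps)
    have u': "norm (u + of_real x0) \<le> \<rho> + \<bar>x0\<bar>"
      using norm_triangle_ineq[of u "of_real x0"] u by simp
    have Re: "\<bar>Re u\<bar> \<le> \<rho>" using u abs_Re_le_cmod[of u] by linarith
    have "- Re (u\<^sup>2) \<le> \<rho>\<^sup>2"
      using abs_Re_le_cmod[of "u\<^sup>2"] power_mono[OF u, of 2] by (simp add: norm_power)
    then have 1: "- (2 * pi * Re (u\<^sup>2)) \<le> 2 * pi * \<rho>\<^sup>2"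
      using mult_left_mono[of "- Re (u\<^sup>2)" "\<rho>\<^sup>2" "2 * pi"] by simp
    have "(t - x0) * Re u \<le> (\<bar>t\<bar> + \<bar>x0\<bar>) * \<rho>"
    proof -
      have "(t - x0) * Re u \<le> \<bar>t - x0\<bar> * \<bar>Re u\<bar>" by (metis abs_ge_self abs_mult)
      also have "\<dots> \<le> (\<bar>t\<bar> + \<bar>x0\<bar>) * \<rho>"
        using Re by (intro mult_mono abs_triangle_ineq4) auto
      finally show ?thesis .
    qed
    then have 2: "4 * pi * (t - x0) * Re u \<le> 4 * pi * ((\<bar>t\<bar> + \<bar>x0\<bar>) * \<rho>)"
      using mult_left_mono[of _ _ "4 * pi"] by (simp add: mult.assoc)
    have "t * x0 \<le> \<bar>t\<bar> * \<bar>x0\<bar>" by (metis abs_ge_self abs_mult)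
    then have "- ((t - x0)\<^sup>2) \<le> 2 * \<bar>x0\<bar> * \<bar>t\<bar> - t\<^sup>2"
      unfolding power2_diff using zero_le_power2[of x0] by (simp only: mult_ac)
    then have 3: "- (pi * (t - x0)\<^sup>2) \<le> pi * (2 * \<bar>x0\<bar> * \<bar>t\<bar> - t\<^sup>2)"
      using mult_left_mono[of "- ((t - x0)\<^sup>2)" "2 * \<bar>x0\<bar> * \<bar>t\<bar> - t\<^sup>2" pi] by simp
    have "norm (gabor x0 \<xi>0 m u t) = norm (herm m (of_real t - (u + of_real x0))) *
        exp (- (pi * (t - x0)\<^sup>2) + 4 * pi * (t - x0) * Re u - 2 * pi * Re (u\<^sup>2))"
      unfolding gabor_def herm norm_mult norm_exp_eq_Re by (simp flip: of_real_power of_real_diff)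
    also have "\<dots> \<le> norm (herm m (of_real t - (u + of_real x0))) * exp ((b * \<bar>t\<bar> - pi * t\<^sup>2) + d)"
    proof (intro mult_left_mono)
      have "(b * \<bar>t\<bar> - pi * t\<^sup>2) + d = pi * (2 * \<bar>x0\<bar> * \<bar>t\<bar> - t\<^sup>2) + 4 * pi * ((\<bar>t\<bar> + \<bar>x0\<bar>) * \<rho>) + 2 * pi * \<rho>\<^sup>2"
        by (simp add: b_def d_def algebra_simps)
      with 1 2 3 show "exp (- (pi * (t - x0)\<^sup>2) + 4 * pi * (t - x0) * Re u - 2 * pi * Re (u\<^sup>2)) \<le> exp ((b * \<bar>t\<bar> - pi * t\<^sup>2) + d)"
        unfolding exp_le_cancel_iff by linarith
    qed simp
    finally have "\<bar>t\<bar> ^ j * norm (gabor x0 \<xi>0 m u t) \<le>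
       \<bar>t\<bar> ^ j * (norm (herm m (of_real t - (u + of_real x0))) * exp ((b * \<bar>t\<bar> - pi * t\<^sup>2) + d))"
      by (rule mult_left_mono) simp
    also have "\<dots> = (\<bar>t\<bar> ^ j * norm (herm m (of_real t - (u + of_real x0))) * exp (b * \<bar>t\<bar> - pi * t\<^sup>2)) * exp d"
      unfolding exp_add by (simp only: mult_ac)
    also have "\<dots> \<le> C * exp d"
      by (rule mult_right_mono[OF C[OF u']]) simp
    finally show ?thesis by (simp add: power_abs)
  qed
  then show ?case by blast
next
  case (Suc k)
  obtain C1 where C1: "\<And>t u. norm u \<le> \<rho> \<Longrightarrow> norm (t ^ j *\<^sub>R gabor_deriv x0 \<xi>0 k (m - 1) u t) \<le> C1"
    using Suc[of "m - 1"] by blast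
  obtain C2 where C2: "\<And>t u. norm u \<le> \<rho> \<Longrightarrow> norm (t ^ j *\<^sub>R gabor_deriv x0 \<xi>0 k (Suc m) u t) \<le> C2"
    using Suc[of "Suc m"] by blast
  obtain C3 where C3: "\<And>t u. norm u \<le> \<rho> \<Longrightarrow> norm (t ^ j *\<^sub>R gabor_deriv x0 \<xi>0 k m u t) \<le> C3"
    using Suc[of m] by blast
  have "norm (t ^ j *\<^sub>R gabor_deriv x0 \<xi>0 (Suc k) m u t) \<le>
      2 * pi * m * C1 + C2 / 2 + 2 * pi * (\<rho> + \<bar>\<xi>0\<bar>) * C3" if u: "norm u \<le> \<rho>" for t u
  proof -
    have "t ^ j *\<^sub>R gabor_deriv x0 \<xi>0 (Suc k) m u t =
        2 * of_real pi * of_nat m * (t ^ j *\<^sub>R gabor_deriv x0 \<xi>0 k (m - 1) u t)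
       - (t ^ j *\<^sub>R gabor_deriv x0 \<xi>0 k (Suc m) u t) / 2
       + 2 * of_real pi * (u - \<i> * of_real \<xi>0) * (t ^ j *\<^sub>R gabor_deriv x0 \<xi>0 k m u t)"
      by (simp add: scaleR_add_right scaleR_diff_right)
    also have "norm \<dots> \<le> 2 * pi * m * C1 + C2 / 2 + 2 * pi * (\<rho> + \<bar>\<xi>0\<bar>) * C3"
    proof (intro order_trans[OF norm_triangle_ineq] order_trans[OF norm_triangle_ineq4] add_mono)
      show "norm (2 * of_real pi * of_nat m * (t ^ j *\<^sub>R gabor_deriv x0 \<xi>0 k (m - 1) u t)) \<le> 2 * pi * m * C1"
        unfolding norm_mult using C1[OF u, of t] by (simp add: mult_left_mono)
      show "norm (t ^ j *\<^sub>R gabor_deriv x0 \<xi>0 k (Suc m) u t / 2) \<le> C2 / 2"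
        unfolding norm_divide using C2[OF u, of t] by simp
      have "norm (u - \<i> * of_real \<xi>0) \<le> \<rho> + \<bar>\<xi>0\<bar>"
        using norm_triangle_ineq4[of u "\<i> * of_real \<xi>0"] u by (simp add: norm_mult)
      then have "norm (2 * of_real pi * (u - \<i> * of_real \<xi>0)) \<le> 2 * pi * (\<rho> + \<bar>\<xi>0\<bar>)"
        by (simp add: norm_mult)
      then show "norm (2 * of_real pi * (u - \<i> * of_real \<xi>0) * (t ^ j *\<^sub>R gabor_deriv x0 \<xi>0 k m u t))
          \<le> 2 * pi * (\<rho> + \<bar>\<xi>0\<bar>) * C3"
        unfolding norm_mult[of "2 * of_real pi * (u - \<i> * of_real \<xi>0)"]
        using C3[OF u, of t] order_trans[OF norm_ge_zero u]
        by (intro mult_mono) (simp_all add: mult_nonneg_nonneg)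
    qed
    finally show ?thesis .
  qed
  then show ?case by blast
qed

lemma iter_deriv_gabor: "iter_deriv k (gabor x0 \<xi>0 m u) = gabor_deriv x0 \<xi>0 k m u"
proof (induction k)
  case 0
  then show ?case by (auto simp: iter_deriv_def)
next
  case (Suc k)
  then show ?case
    using vector_derivative_at[OF gabor_deriv_has_vector_derivative]
    by (auto simp: iter_deriv_def simp del: gabor_deriv.simps)
qed

lemma gabor_schwartz: "gabor x0 \<xi>0 m u \<in> schwartz"
proof -
  have "bounded (range (\<lambda>t. t ^ j *\<^sub>R gabor_deriv x0 \<xi>0 k m u t))" for j k
    using gabor_deriv_bound[of "norm u" j x0 \<xi>0 k m] by (auto simp: bounded_iff)
  moreover have "gabor_deriv x0 \<xi>0 k m u differentiable at t" for k t
    using gabor_deriv_has_vector_derivative[of x0 \<xi>0 k m u t]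
    unfolding has_vector_derivative_def differentiable_def by blast
  ultimately show ?thesis
    unfolding schwartz_def mem_Collect_eq iter_deriv_gabor by blast
qed

text \<open>The second-order Taylor remainder in the parameter is small in every Schwartz seminorm: each
  \<open>t\<close>-derivative of it is the Taylor remainder of \<^const>\<open>gabor_deriv\<close>, whose second derivative in \<open>u\<close>
  is bounded locally uniformly in \<open>u\<close>, even after multiplication by \<open>t ^ j\<close>.\<close>

lemma tempered_gabor_remainder:
  assumes f: "tempered_distribution f"
  shows "\<exists>K. \<forall>v. norm (v - u) \<le> 1 \<longrightarrow>
    norm (f (gabor x0 \<xi>0 m v) - f (gabor x0 \<xi>0 m u) - (v - u) * f (gabor x0 \<xi>0 (Suc m) u))
      \<le> K * norm (v - u) ^ 2"
proof -
  obtain N B where NB: "\<And>\<phi>. \<phi> \<in> schwartz \<Longrightarrow> norm (f \<phi>) \<le> B * (\<Sum>j\<le>N. \<Sum>k\<le>N. schwartz_seminorm j k \<phi>)"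
    using f unfolding tempered_distribution_def by blast
  have "\<forall>j k. \<exists>C. \<forall>t v. norm v \<le> norm u + 1 \<longrightarrow> norm (t ^ j *\<^sub>R gabor_deriv x0 \<xi>0 k (m + 2) v t) \<le> C"
    using gabor_deriv_bound by blast
  then obtain C where C: "\<And>j k t v. norm v \<le> norm u + 1 \<Longrightarrow> norm (t ^ j *\<^sub>R gabor_deriv x0 \<xi>0 k (m + 2) v t) \<le> C j k"
    by metis
  have "norm (f (gabor x0 \<xi>0 m v) - f (gabor x0 \<xi>0 m u) - (v - u) * f (gabor x0 \<xi>0 (Suc m) u))
      \<le> (\<bar>B\<bar> * (\<Sum>j\<le>N. \<Sum>k\<le>N. C j k)) * norm (v - u) ^ 2" if v: "norm (v - u) \<le> 1" for v
  proof -
    define \<psi> where "\<psi> = (\<lambda>t. (- 1) * gabor x0 \<xi>0 m u t + (- (v - u)) * gabor x0 \<xi>0 (Suc m) u t)"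
    define \<phi> where "\<phi> = (\<lambda>t. 1 * gabor x0 \<xi>0 m v t + 1 * \<psi> t)"
    have \<psi>: "\<psi> \<in> schwartz" unfolding \<psi>_def by (intro schwartz_linear gabor_schwartz)
    have \<phi>: "\<phi> \<in> schwartz" unfolding \<phi>_def by (intro schwartz_linear gabor_schwartz \<psi>)
    have f\<phi>: "f \<phi> = f (gabor x0 \<xi>0 m v) - f (gabor x0 \<xi>0 m u) - (v - u) * f (gabor x0 \<xi>0 (Suc m) u)"
      unfolding \<phi>_def tempered_linear[OF f gabor_schwartz \<psi>]
      unfolding \<psi>_def tempered_linear[OF f gabor_schwartz gabor_schwartz] by (simp add: algebra_simps)
    have iter: "iter_deriv k \<phi> t = gabor_deriv x0 \<xi>0 k m v t - gabor_deriv x0 \<xi>0 k m u t - (v - u) * gabor_deriv x0 \<xi>0 k (Suc m) u t" for k t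
      unfolding \<phi>_def iter_deriv_linear[OF gabor_schwartz \<psi>]
      unfolding \<psi>_def iter_deriv_linear[OF gabor_schwartz gabor_schwartz] iter_deriv_gabor by (simp add: algebra_simps)
    have "norm (t ^ j *\<^sub>R iter_deriv k \<phi> t) \<le> C j k * norm (v - u) ^ 2" for j k t
    proof -
      have "norm (t ^ j *\<^sub>R gabor_deriv x0 \<xi>0 k (m + 0) v t
          - (\<Sum>i\<le>1. (t ^ j *\<^sub>R gabor_deriv x0 \<xi>0 k (m + i) u t) * (v - u) ^ i / fact i))
          \<le> C j k * norm (v - u) ^ Suc 1 / fact 1"
      proof (rule field_Taylor[where S = "cball u 1"])
        fix i x assume "x \<in> cball u 1" "i \<le> (1::nat)"
        show "((\<lambda>v. t ^ j *\<^sub>R gabor_deriv x0 \<xi>0 k (m + i) v t) has_field_derivative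
           t ^ j *\<^sub>R gabor_deriv x0 \<xi>0 k (m + Suc i) x t) (at x within cball u 1)"
          unfolding scaleR_conv_of_real add_Suc_right
          by (rule has_field_derivative_at_within, rule DERIV_cmult, rule gabor_deriv_has_field_derivative)
      next
        fix x assume "x \<in> cball u 1"
        then have "norm x \<le> norm u + 1"
          using norm_triangle_ineq2[of x u] by (simp add: dist_norm norm_minus_commute)
        then show "norm (t ^ j *\<^sub>R gabor_deriv x0 \<xi>0 k (m + Suc 1) x t) \<le> C j k"
          using C by simp
      qed (use v in \<open>auto simp: dist_norm norm_minus_commute\<close>)
      then show ?thesis
        unfolding iter by (simp add: scaleR_diff_right numeral_2_eq_2 algebra_simps)
    qed
    then have "schwartz_seminorm j k \<phi> \<le> C j k * norm (v - u) ^ 2" for j k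
      unfolding schwartz_seminorm_def by (intro cSUP_least) auto
    then have "(\<Sum>j\<le>N. \<Sum>k\<le>N. schwartz_seminorm j k \<phi>) \<le> (\<Sum>j\<le>N. \<Sum>k\<le>N. C j k * norm (v - u) ^ 2)"
      by (intro sum_mono)
    moreover have "0 \<le> schwartz_seminorm j k \<phi>" for j k
    proof -
      have "bdd_above (range (\<lambda>t. norm (t ^ j *\<^sub>R iter_deriv k \<phi> t)))"
        using \<phi> unfolding schwartz_def bounded_iff bdd_above_def by blast
      then show ?thesis
        unfolding schwartz_seminorm_def by (rule cSUP_upper2[where x = 0]) auto
    qed
    then have "0 \<le> (\<Sum>j\<le>N. \<Sum>k\<le>N. schwartz_seminorm j k \<phi>)" by (intro sum_nonneg)
    ultimately have "\<bar>B\<bar> * (\<Sum>j\<le>N. \<Sum>k\<le>N. schwartz_seminorm j k \<phi>) \<le> \<bar>B\<bar> * (\<Sum>j\<le>N. \<Sum>k\<le>N. C j k * norm (v - u) ^ 2)"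
      and "B * (\<Sum>j\<le>N. \<Sum>k\<le>N. schwartz_seminorm j k \<phi>) \<le> \<bar>B\<bar> * (\<Sum>j\<le>N. \<Sum>k\<le>N. schwartz_seminorm j k \<phi>)"
      by (auto intro: mult_left_mono mult_right_mono)
    with NB[OF \<phi>] show ?thesis
      unfolding f\<phi> by (simp add: sum_distrib_right mult.assoc)
  qed
  then show ?thesis by blast
qed

lemma tempered_gabor_has_field_derivative:
  assumes f: "tempered_distribution f"
  shows "((\<lambda>u. f (gabor x0 \<xi>0 m u)) has_field_derivative f (gabor x0 \<xi>0 (Suc m) u)) (at u)"
proof -
  obtain K where K: "\<And>v. norm (v - u) \<le> 1 \<Longrightarrow>
    norm (f (gabor x0 \<xi>0 m v) - f (gabor x0 \<xi>0 m u) - (v - u) * f (gabor x0 \<xi>0 (Suc m) u))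
      \<le> K * norm (v - u) ^ 2"
    using tempered_gabor_remainder[OF f, of u x0 \<xi>0 m] by blast
  have "((\<lambda>v. (f (gabor x0 \<xi>0 m v) - f (gabor x0 \<xi>0 m u)) / (v - u) - f (gabor x0 \<xi>0 (Suc m) u)) \<longlongrightarrow> 0) (at u)"
  proof (rule Lim_null_comparison)
    have "\<forall>\<^sub>F v in at u. dist v u < 1"
      by (intro eventually_at_ball'[THEN eventually_mono, of 1 u UNIV]) (auto simp: dist_commute)
    moreover have "\<forall>\<^sub>F v in at u. v \<noteq> u"
      by (simp add: eventually_at_filter)
    ultimately show "\<forall>\<^sub>F v in at u. norm ((f (gabor x0 \<xi>0 m v) - f (gabor x0 \<xi>0 m u)) / (v - u) - f (gabor x0 \<xi>0 (Suc m) u)) \<le> K * norm (v - u)"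
    proof eventually_elim
      case (elim v)
      have "(f (gabor x0 \<xi>0 m v) - f (gabor x0 \<xi>0 m u)) / (v - u) - f (gabor x0 \<xi>0 (Suc m) u)
        = (f (gabor x0 \<xi>0 m v) - f (gabor x0 \<xi>0 m u) - (v - u) * f (gabor x0 \<xi>0 (Suc m) u)) / (v - u)"
        using elim by (simp add: diff_divide_distrib)
      also have "norm \<dots> \<le> K * norm (v - u) ^ 2 / norm (v - u)"
        unfolding norm_divide using K[of v] elim by (intro divide_right_mono) (auto simp: dist_norm)
      also have "\<dots> = K * norm (v - u)" using elim by (simp add: power2_eq_square)
      finally show ?case .
    qed
    show "((\<lambda>v. K * norm (v - u)) \<longlongrightarrow> 0) (at u)"
      by (rule tendsto_eq_intros refl)+ simp
  qed
  then show ?thesis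
    unfolding has_field_derivative_iff by (rule LIM_zero_cancel)
qed

text \<open>The algebraic heart of the proof. The argument \<open>t - x0 - x\<close> of the shifted Hermite polynomial is
  the sum of \<open>t - x0 - \<zeta>/2\<close> and \<open>- cnj \<zeta> / 2\<close>, so \<open>herm_add\<close> separates the holomorphic from the
  antiholomorphic dependence on the shift; the Gaussian exponents are matched by completing
  the square, at the price of a phase and of the factor \<open>exp (- \<pi> |\<zeta>|\<^sup>2 / 2)\<close>.\<close>

lemma cnj_tf_shift_hermite:
  fixes x \<xi> :: real
  defines "\<zeta> \<equiv> Complex x (- \<xi>)"
  shows "cnj (tf_shift (x0 + x, \<xi>0 + \<xi>) (hermite r) t) =
     of_real (hermite_norm r) * exp (- (\<i> * of_real (pi * \<xi> * (2 * x0 + x)))) * of_real (exp (- pi * (x\<^sup>2 + \<xi>\<^sup>2) / 2)) *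
     (\<Sum>k\<le>r. of_nat (r choose k) * (- (2 * of_real pi * cnj \<zeta>)) ^ (r - k) * gabor x0 \<xi>0 k (\<zeta> / 2) t)"
proof -
  define s where "s = t - x0"
  define E where "E = exp (- (2 * of_real pi * \<i> * of_real (\<xi>0 * t)) - of_real pi * (of_real s)\<^sup>2
       + 4 * of_real pi * of_real s * (\<zeta>/2) - 2 * of_real pi * (\<zeta>/2)\<^sup>2)"
  have \<zeta>: "\<zeta> = of_real x - \<i> * of_real \<xi>" "cnj \<zeta> = of_real x + \<i> * of_real \<xi>"
    by (auto simp: \<zeta>_def complex_eq_iff)
  have "(\<Sum>k\<le>r. of_nat (r choose k) * (- (2 * of_real pi * cnj \<zeta>)) ^ (r - k) * gabor x0 \<xi>0 k (\<zeta> / 2) t)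
      = (\<Sum>k\<le>r. of_nat (r choose k) * (of_real (4 * pi) * (- (cnj \<zeta> / 2))) ^ (r - k) * herm k (of_real s - \<zeta>/2)) * E"
    unfolding gabor_def s_def[symmetric] E_def[symmetric] sum_distrib_right
    by (intro sum.cong refl) (simp add: mult_ac)
  also have "\<dots> = herm r (of_real s - \<zeta>/2 + (- (cnj \<zeta> / 2))) * E"
    unfolding herm_add ..
  also have "of_real s - \<zeta>/2 + (- (cnj \<zeta> / 2)) = of_real (s - x)"
    by (simp add: \<zeta> field_simps)
  finally have sum: "(\<Sum>k\<le>r. of_nat (r choose k) * (- (2 * of_real pi * cnj \<zeta>)) ^ (r - k) * gabor x0 \<xi>0 k (\<zeta> / 2) t)
      = of_real (herm r (s - x)) * E"
    by (simp only: herm_of_real)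
  have ex: "exp (- (\<i> * of_real (pi * \<xi> * (2 * x0 + x)))) * of_real (exp (- pi * (x\<^sup>2 + \<xi>\<^sup>2) / 2)) * E
     = exp (- (2 * of_real pi * \<i> * of_real ((\<xi>0 + \<xi>) * t))) * of_real (exp (- pi * (s - x)\<^sup>2))"
  proof -
    have "- (\<i> * of_real (pi * \<xi> * (2 * x0 + x))) + of_real (- pi * (x\<^sup>2 + \<xi>\<^sup>2) / 2)
       + (- (2 * of_real pi * \<i> * of_real (\<xi>0 * t)) - of_real pi * (of_real s)\<^sup>2
       + 4 * of_real pi * of_real s * (\<zeta>/2) - 2 * of_real pi * (\<zeta>/2)\<^sup>2)
      = - (2 * of_real pi * \<i> * of_real ((\<xi>0 + \<xi>) * t)) + of_real (- pi * (s - x)\<^sup>2)"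
      by (simp add: \<zeta>(1) s_def complex_eq_iff power2_eq_square field_simps)
    then show ?thesis
      unfolding E_def exp_of_real[symmetric] exp_add[symmetric] by (simp only:)
  qed
  have "cnj (tf_shift (x0 + x, \<xi>0 + \<xi>) (hermite r) t) =
     exp (- (2 * of_real pi * \<i> * of_real ((\<xi>0 + \<xi>) * t))) *
       of_real (hermite_norm r * herm r (s - x) * exp (- pi * (s - x)\<^sup>2))"
    unfolding tf_shift_def hermite_eq by (simp add: exp_cnj s_def diff_diff_eq)
  also have "\<dots> = of_real (hermite_norm r) * (exp (- (2 * of_real pi * \<i> * of_real ((\<xi>0 + \<xi>) * t))) * of_real (exp (- pi * (s - x)\<^sup>2))) * of_real (herm r (s - x))"
    by (simp only: of_real_mult mult_ac)
  finally show ?thesis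
    unfolding ex[symmetric] sum by (simp only: mult_ac)
qed

lemma stft_hermite_expansion:
  fixes x \<xi> :: real
  assumes f: "tempered_distribution f"
  defines "\<zeta> \<equiv> Complex x (- \<xi>)"
  shows "stft (hermite r) f (x0 + x, \<xi>0 + \<xi>) =
     of_real (hermite_norm r) * exp (- (\<i> * of_real (pi * \<xi> * (2 * x0 + x)))) * of_real (exp (- pi * (x\<^sup>2 + \<xi>\<^sup>2) / 2)) *
     (\<Sum>k\<le>r. of_nat (r choose k) * (- (2 * of_real pi * cnj \<zeta>)) ^ (r - k) * f (gabor x0 \<xi>0 k (\<zeta> / 2)))"
proof -
  define c where "c = of_real (hermite_norm r) * exp (- (\<i> * of_real (pi * \<xi> * (2 * x0 + x)))) * of_real (exp (- pi * (x\<^sup>2 + \<xi>\<^sup>2) / 2))"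
  define a where "a k = of_nat (r choose k) * (- (2 * of_real pi * cnj \<zeta>)) ^ (r - k)" for k
  note sum = tempered_sum[OF f, of "{..r}" "\<lambda>k. gabor x0 \<xi>0 k (\<zeta> / 2)" a, OF _ _ gabor_schwartz]
  have "stft (hermite r) f (x0 + x, \<xi>0 + \<xi>) = f (\<lambda>t. c * (\<Sum>k\<le>r. a k * gabor x0 \<xi>0 k (\<zeta> / 2) t))"
    unfolding stft_def dual_pairing_def cnj_tf_shift_hermite c_def a_def \<zeta>_def ..
  also have "\<dots> = c * f (\<lambda>t. \<Sum>k\<le>r. a k * gabor x0 \<xi>0 k (\<zeta> / 2) t)"
    using f sum unfolding tempered_distribution_def by simp
  also have "\<dots> = c * (\<Sum>k\<le>r. a k * f (gabor x0 \<xi>0 k (\<zeta> / 2)))"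
    using sum by simp
  finally show ?thesis unfolding c_def a_def .
qed

section \<open>Integrals over discs in the plane\<close>

lemma nn_integral_shear_fst:
  fixes f :: "real \<times> real \<Rightarrow> ennreal"
  assumes [measurable]: "f \<in> borel_measurable borel"
  shows "(\<integral>\<^sup>+z. f (fst z + a * snd z, snd z) \<partial>lborel) = (\<integral>\<^sup>+z. f z \<partial>lborel)"
proof -
  have shear: "(\<lambda>z. f (fst z + a * snd z, snd z)) \<in> borel_measurable borel"
    by (rule measurable_compose[OF _ assms])
       (intro borel_measurable_continuous_onI continuous_intros)
  have "(\<integral>\<^sup>+z. f (fst z + a * snd z, snd z) \<partial>lborel) = (\<integral>\<^sup>+z. f (fst z + a * snd z, snd z) \<partial>(lborel \<Otimes>\<^sub>M lborel))"
    by (simp add: lborel_prod)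
  also have "\<dots> = (\<integral>\<^sup>+y. \<integral>\<^sup>+x. f (x + a * y, y) \<partial>lborel \<partial>lborel)"
    by (subst lborel_pair.nn_integral_snd[symmetric]) (simp_all add: lborel_prod shear)
  also have "\<dots> = (\<integral>\<^sup>+y. \<integral>\<^sup>+x. f (x, y) \<partial>lborel \<partial>lborel)"
  proof (rule nn_integral_cong)
    fix y :: real
    show "(\<integral>\<^sup>+x. f (x + a * y, y) \<partial>lborel) = (\<integral>\<^sup>+x. f (x, y) \<partial>lborel)"
      using nn_integral_real_affine[of "\<lambda>x. f (x, y)" 1 "a * y"] by (simp add: add.commute)
  qed
  also have "\<dots> = (\<integral>\<^sup>+z. f z \<partial>(lborel \<Otimes>\<^sub>M lborel))"
    by (subst lborel_pair.nn_integral_snd[symmetric]) (simp_all add: lborel_prod)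
  finally show ?thesis by (simp add: lborel_prod)
qed

lemma nn_integral_shear_snd:
  fixes f :: "real \<times> real \<Rightarrow> ennreal"
  assumes [measurable]: "f \<in> borel_measurable borel"
  shows "(\<integral>\<^sup>+z. f (fst z, snd z + a * fst z) \<partial>lborel) = (\<integral>\<^sup>+z. f z \<partial>lborel)"
proof -
  have shear: "(\<lambda>z. f (fst z, snd z + a * fst z)) \<in> borel_measurable borel"
    by (rule measurable_compose[OF _ assms])
       (intro borel_measurable_continuous_onI continuous_intros)
  have "(\<integral>\<^sup>+z. f (fst z, snd z + a * fst z) \<partial>lborel) = (\<integral>\<^sup>+z. f (fst z, snd z + a * fst z) \<partial>(lborel \<Otimes>\<^sub>M lborel))"
    by (simp add: lborel_prod)
  also have "\<dots> = (\<integral>\<^sup>+x. \<integral>\<^sup>+y. f (x, y + a * x) \<partial>lborel \<partial>lborel)"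
    by (subst lborel.nn_integral_fst[symmetric]) (simp_all add: lborel_prod shear)
  also have "\<dots> = (\<integral>\<^sup>+x. \<integral>\<^sup>+y. f (x, y) \<partial>lborel \<partial>lborel)"
  proof (rule nn_integral_cong)
    fix x :: real
    show "(\<integral>\<^sup>+y. f (x, y + a * x) \<partial>lborel) = (\<integral>\<^sup>+y. f (x, y) \<partial>lborel)"
      using nn_integral_real_affine[of "\<lambda>y. f (x, y)" 1 "a * x"] by (simp add: add.commute)
  qed
  also have "\<dots> = (\<integral>\<^sup>+z. f z \<partial>(lborel \<Otimes>\<^sub>M lborel))"
    by (subst lborel.nn_integral_fst[symmetric]) (simp_all add: lborel_prod)
  finally show ?thesis by (simp add: lborel_prod)
qed

definition rotate_plane :: "real \<Rightarrow> real \<times> real \<Rightarrow> real \<times> real" where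
  "rotate_plane \<theta> z = (cos \<theta> * fst z - sin \<theta> * snd z, sin \<theta> * fst z + cos \<theta> * snd z)"

lemma measurable_rotate_plane [measurable]: "rotate_plane \<theta> \<in> borel_measurable borel"
  unfolding rotate_plane_def
  by (intro borel_measurable_continuous_onI continuous_intros)

lemma norm_rotate_plane: "norm (rotate_plane \<theta> z) = norm z"
proof -
  have "(cos \<theta> * fst z - sin \<theta> * snd z)\<^sup>2 + (sin \<theta> * fst z + cos \<theta> * snd z)\<^sup>2
     = ((cos \<theta>)\<^sup>2 + (sin \<theta>)\<^sup>2) * ((fst z)\<^sup>2 + (snd z)\<^sup>2)"
    by algebra
  then show ?thesis
    by (simp add: rotate_plane_def norm_prod_def)
qed

text \<open>A rotation other than the half turn factors into three shears, and a shear preserves Lebesgue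
  measure by Fubini and translation invariance on each line.\<close>

lemma distr_rotate_plane:
  assumes "cos \<theta> \<noteq> - 1"
  shows "distr lborel borel (rotate_plane \<theta>) = lborel"
proof (rule measure_eqI)
  fix A assume "A \<in> sets (distr lborel borel (rotate_plane \<theta>))"
  then have [measurable]: "A \<in> sets borel" by simp
  define a where "a = - sin \<theta> / (1 + cos \<theta>)"
  have nz: "1 + cos \<theta> \<noteq> 0" using assms by (simp add: add_eq_0_iff)
  have ac: "a * (1 + cos \<theta>) = - sin \<theta>" using nz by (simp add: a_def)
  have as: "1 + a * sin \<theta> = cos \<theta>"
  proof -
    have "(a * sin \<theta>) * (1 + cos \<theta>) = (cos \<theta> - 1) * (1 + cos \<theta>)"
      using ac sin_cos_squared_add[of \<theta>] by algebra
    then show ?thesis using nz by simp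
  qed
  \<comment> \<open>shear along the first axis by \<open>a\<close>, along the second by \<open>sin \<theta>\<close>, along the first by \<open>a\<close> again\<close>
  have rot: "rotate_plane \<theta> z = (let u = (fst z + a * snd z, snd z); v = (fst u, snd u + sin \<theta> * fst u)
      in (fst v + a * snd v, snd v))" for z
  proof -
    have "snd z + sin \<theta> * (fst z + a * snd z) = sin \<theta> * fst z + (1 + a * sin \<theta>) * snd z"
      by (simp add: algebra_simps)
    moreover have "(fst z + a * snd z) + a * (sin \<theta> * fst z + cos \<theta> * snd z)
        = (1 + a * sin \<theta>) * fst z + (a * (1 + cos \<theta>)) * snd z"
      by (simp add: algebra_simps)
    ultimately show ?thesis unfolding as ac by (simp add: rotate_plane_def Let_def)
  qed
  have m: "(\<lambda>z. indicator A (fst z + a * snd z, snd z) :: ennreal) \<in> borel_measurable borel"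
    by (rule measurable_compose[OF _ borel_measurable_indicator])
       (auto intro!: borel_measurable_continuous_onI continuous_intros)
  have m': "(\<lambda>z. indicator A (fst z + a * (snd z + sin \<theta> * fst z), snd z + sin \<theta> * fst z) :: ennreal) \<in> borel_measurable borel"
    by (rule measurable_compose[OF _ borel_measurable_indicator])
       (auto intro!: borel_measurable_continuous_onI continuous_intros)
  have "emeasure (distr lborel borel (rotate_plane \<theta>)) A = (\<integral>\<^sup>+z. indicator A z \<partial>distr lborel borel (rotate_plane \<theta>))"
    by simp
  also have "\<dots> = (\<integral>\<^sup>+z. indicator A (rotate_plane \<theta> z) \<partial>lborel)"
    by (rule nn_integral_distr) auto
  also have "\<dots> = (\<integral>\<^sup>+z. indicator A z \<partial>lborel)"
    unfolding rot Let_def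
    using nn_integral_shear_fst[OF m', of a] nn_integral_shear_snd[OF m, of "sin \<theta>"]
      nn_integral_shear_fst[of "indicator A" a] by simp
  finally show "emeasure (distr lborel borel (rotate_plane \<theta>)) A = emeasure lborel A" by simp
qed simp

text \<open>The conjugate of \<open>x + i\<xi>\<close> is the right variable because the product of \<open>exp (- 2 \<pi> i \<xi> t)\<close>
  and \<open>exp (2 \<pi> x t)\<close>, which a time-frequency shift of a Gaussian involves, is \<open>exp (2 \<pi> \<zeta> t)\<close>.\<close>

abbreviation zeta :: "real \<times> real \<Rightarrow> complex" where
  "zeta z \<equiv> Complex (fst z) (- snd z)"

lemma norm_zeta: "norm (zeta z) = norm z"
  by (simp add: cmod_def norm_prod_def)

lemma continuous_on_zeta [continuous_intros]:
  "continuous_on A f \<Longrightarrow> continuous_on A (\<lambda>x. zeta (f x))"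
  by (simp add: Complex_eq) (intro continuous_intros)

lemma zeta_rotate_plane: "zeta (rotate_plane \<theta> z) = cis (- \<theta>) * zeta z"
  by (simp add: rotate_plane_def complex_eq_iff algebra_simps)

text \<open>A rotation multiplies the integrand by a constant phase without changing the integral. The angle is
  chosen such that the phase is \<open>-i\<close>; it is at most a quarter turn in absolute value.\<close>

lemma disc_integral_monomial_eq_0:
  fixes q :: "real \<Rightarrow> real"
  assumes "m \<noteq> j" and [measurable]: "q \<in> borel_measurable borel"
  shows "(LINT z:ball 0 R|lborel. of_real (q (norm z)) * cnj (zeta z) ^ j * zeta z ^ m) = 0"
proof -
  define \<theta> where "\<theta> = pi / 2 / (real m - real j)"
  have [measurable]: "zeta \<in> borel_measurable borel"
    by (intro borel_measurable_continuous_onI continuous_intros)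
  have [measurable]: "(\<lambda>z. cnj (zeta z)) \<in> borel_measurable borel"
    by (intro borel_measurable_continuous_onI continuous_intros)
  have [measurable]: "ball (0 :: real \<times> real) R \<in> sets borel" by simp
  define g where "g z = indicator (ball 0 R) z *\<^sub>R (of_real (q (norm z)) * cnj (zeta z) ^ j * zeta z ^ m)" for z
  have [measurable]: "g \<in> borel_measurable borel" unfolding g_def by measurable
  have "1 \<le> \<bar>real m - real j\<bar>" using assms by (cases "m < j") auto
  then have "\<bar>\<theta>\<bar> \<le> pi / 2" by (auto simp: \<theta>_def abs_divide field_simps)
  then have "cos \<theta> \<ge> 0" by (intro cos_ge_zero) auto
  then have cos: "cos \<theta> \<noteq> -1" by auto
  have "cnj (cis (-\<theta>)) ^ j * cis (-\<theta>) ^ m = cis (- (\<theta> * (real m - real j)))"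
    by (simp add: cis_cnj Complex.DeMoivre cis_mult algebra_simps)
  also have "\<theta> * (real m - real j) = pi / 2"
    using \<open>1 \<le> \<bar>real m - real j\<bar>\<close> unfolding \<theta>_def by (subst nonzero_eq_divide_eq[symmetric]) auto
  finally have c: "cnj (cis (-\<theta>)) ^ j * cis (-\<theta>) ^ m = - \<i>" by (simp add: complex_eq_iff)
  have "integral\<^sup>L lborel g = integral\<^sup>L (distr lborel borel (rotate_plane \<theta>)) g"
    by (simp add: distr_rotate_plane[OF cos])
  also have "\<dots> = (LINT z|lborel. g (rotate_plane \<theta> z))"
    by (rule integral_distr) auto
  also have "\<dots> = (LINT z|lborel. (cnj (cis (-\<theta>)) ^ j * cis (-\<theta>) ^ m) * g z)"
    by (intro Bochner_Integration.integral_cong refl)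
       (simp add: g_def norm_rotate_plane zeta_rotate_plane power_mult_distrib indicator_def)
  also have "\<dots> = - \<i> * integral\<^sup>L lborel g" unfolding c by simp
  finally have eq: "integral\<^sup>L lborel g = - \<i> * integral\<^sup>L lborel g" .
  have "integral\<^sup>L lborel g * (1 + \<i>) = integral\<^sup>L lborel g - (- \<i> * integral\<^sup>L lborel g)"
    by (simp add: algebra_simps)
  also have "\<dots> = 0" by (simp only: eq[symmetric] diff_self)
  finally have "integral\<^sup>L lborel g * (1 + \<i>) = 0" .
  then have "integral\<^sup>L lborel g = 0" by (simp add: complex_eq_iff)
  then show ?thesis unfolding set_lebesgue_integral_def g_def .
qed

text \<open>The area of the disc of radius \<open>s\<close> is \<open>\<pi> s\<^sup>2\<close>, so the image of Lebesgue measure on the disc under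
  \<open>z \<mapsto> \<pi> |z|\<^sup>2\<close> and Lebesgue measure on the interval from \<open>0\<close> to \<open>\<pi> R\<^sup>2\<close> agree on half-lines.\<close>

lemma disc_integral_radial:
  fixes q :: "real \<Rightarrow> real"
  assumes R: "0 < R" and [measurable]: "q \<in> borel_measurable borel"
  shows "(LINT z:ball (0 :: real \<times> real) R|lborel. q (pi * (norm z)\<^sup>2)) = (LINT t:{0..pi * R\<^sup>2}|lborel. q t)"
proof -
  define B where "B = ball (0 :: real \<times> real) R"
  define p where "p z = pi * (norm z)\<^sup>2" for z :: "real \<times> real"
  have [measurable]: "B \<in> sets borel" by (simp add: B_def)
  have [measurable]: "p \<in> borel_measurable borel" unfolding p_def[abs_def] by measurable
  have area: "emeasure lborel (ball (0 :: real \<times> real) s) = pi * s\<^sup>2" "emeasure lborel (cball (0 :: real \<times> real) s) = pi * s\<^sup>2" if "s \<ge> 0" for s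
    using that by (simp_all add: emeasure_ball emeasure_cball unit_ball_vol_2 power2_eq_square)
  define M where "M = distr (density lborel (indicator B)) borel p"
  define N where "N = density lborel (indicator {0..pi * R\<^sup>2} :: real \<Rightarrow> ennreal)"
  have M: "emeasure M {x<..} = emeasure lborel (B \<inter> {z. x < p z})" for x
  proof -
    have "emeasure M {x<..} = emeasure (density lborel (indicator B)) {z. x < p z}"
      unfolding M_def by (subst emeasure_distr) (auto simp: vimage_def space_borel)
    also have "\<dots> = (\<integral>\<^sup>+z. indicator B z * indicator {z. x < p z} z \<partial>lborel)"
      by (rule emeasure_density) measurable
    also have "\<dots> = (\<integral>\<^sup>+z. indicator (B \<inter> {z. x < p z}) z \<partial>lborel)"
      by (simp only: indicator_inter_arith)
    also have "\<dots> = emeasure lborel (B \<inter> {z. x < p z})"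
      by (rule nn_integral_indicator) measurable
    finally show ?thesis .
  qed
  have N: "emeasure N {x<..} = emeasure lborel ({0..pi * R\<^sup>2} \<inter> {x<..})" for x
  proof -
    have "emeasure N {x<..} = (\<integral>\<^sup>+z. indicator {0..pi * R\<^sup>2} z * indicator {x<..} z \<partial>lborel)"
      unfolding N_def by (rule emeasure_density) measurable
    also have "\<dots> = (\<integral>\<^sup>+z. indicator ({0..pi * R\<^sup>2} \<inter> {x<..}) z \<partial>lborel)"
      by (simp only: indicator_inter_arith)
    also have "\<dots> = emeasure lborel ({0..pi * R\<^sup>2} \<inter> {x<..})"
      by (rule nn_integral_indicator) measurable
    finally show ?thesis .
  qed
  have "M = N"
  proof (rule measure_eqI_lessThan)
    fix x :: real
    have "emeasure M {x<..} \<le> emeasure lborel B" unfolding M by (rule emeasure_mono) auto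
    also have "\<dots> < \<infinity>" using area(1)[of R] R by (simp add: B_def)
    finally show "emeasure M {x<..} < \<infinity>" .
    consider "x < 0" | "0 \<le> x" "x < pi * R\<^sup>2" | "pi * R\<^sup>2 \<le> x" by linarith
    then show "emeasure M {x<..} = emeasure N {x<..}"
    proof cases
      case 1
      then have "B \<inter> {z. x < p z} = B" "{0..pi * R\<^sup>2} \<inter> {x<..} = {0..pi * R\<^sup>2}"
        by (auto simp: p_def intro: less_le_trans)
      then show ?thesis unfolding M N using area(1)[of R] R by (simp add: B_def)
    next
      case 2
      define s where "s = sqrt (x / pi)"
      have s: "s \<ge> 0" "pi * s\<^sup>2 = x" using 2 by (simp_all add: s_def)
      then have "s < R" using 2 R by (metis mult_less_cancel_left_pos pi_gt_zero power2_less_imp_less less_imp_le)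
      have "x < p z \<longleftrightarrow> s < norm z" for z
      proof -
        have "x < p z \<longleftrightarrow> s\<^sup>2 < (norm z)\<^sup>2"
          unfolding p_def s(2)[symmetric] by simp
        also have "\<dots> \<longleftrightarrow> s < norm z"
          using s(1) by (meson norm_ge_zero power2_less_imp_less power_strict_mono pos2)
        finally show ?thesis .
      qed
      then have "B \<inter> {z. x < p z} = B - cball 0 s" by (auto simp: B_def)
      also have "emeasure lborel \<dots> = emeasure lborel B - emeasure lborel (cball (0 :: real \<times> real) s)"
        using \<open>s < R\<close> s area by (intro emeasure_Diff) (auto simp: B_def)
      also have "\<dots> = ennreal (pi * R\<^sup>2 - x)"
        using area(1)[of R] area(2)[of s] s R 2 by (simp add: B_def ennreal_minus)
      finally have "emeasure M {x<..} = ennreal (pi * R\<^sup>2 - x)" unfolding M .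
      moreover have "{0..pi * R\<^sup>2} \<inter> {x<..} = {x<..pi * R\<^sup>2}" using 2 by auto
      ultimately show ?thesis unfolding N using 2 by simp
    next
      case 3
      have "B \<inter> {z. x < p z} = {}"
      proof safe
        fix z assume "z \<in> B" "x < p z"
        then have "(norm z)\<^sup>2 < R\<^sup>2" using R by (simp add: B_def power_strict_mono)
        then have "p z < pi * R\<^sup>2" by (simp add: p_def)
        with 3 \<open>x < p z\<close> show "z \<in> {}" by simp
      qed
      moreover have "{0..pi * R\<^sup>2} \<inter> {x<..} = {}" using 3 by auto
      ultimately show ?thesis unfolding M N by simp
    qed
  qed (auto simp: M_def N_def)
  have "(LINT z:B|lborel. q (p z)) = (LINT z|density lborel (indicator B). q (p z))"
    unfolding set_lebesgue_integral_def
    using integral_density[of "\<lambda>z. q (p z)" lborel "indicator B"] by (simp add: ennreal_indicator)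
  also have "\<dots> = integral\<^sup>L M q"
    unfolding M_def by (subst integral_distr) auto
  also have "\<dots> = integral\<^sup>L N q" using \<open>M = N\<close> by simp
  also have "\<dots> = (LINT t:{0..pi * R\<^sup>2}|lborel. q t)"
    unfolding set_lebesgue_integral_def N_def
    using integral_density[of q lborel "indicator {0..pi * R\<^sup>2}"] by (simp add: ennreal_indicator)
  finally show ?thesis unfolding B_def p_def .
qed

lemma set_integrable_disc_continuous:
  fixes h :: "real \<times> real \<Rightarrow> 'a::{banach, second_countable_topology}"
  assumes "continuous_on UNIV h"
  shows "set_integrable lborel (ball 0 R) h"
proof -
  have "set_integrable lborel (cball 0 R) h"
    by (rule borel_integrable_compact[unfolded set_integrable_def[symmetric]])
       (auto intro: continuous_on_subset[OF assms])
  then show ?thesis by (rule set_integrable_subset) auto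
qed

text \<open>The power series converges absolutely and uniformly on the disc, so it may be integrated term by
  term; by rotation invariance only the term of order \<open>j\<close> contributes.\<close>

lemma disc_integral_power_series:
  fixes q :: "real \<Rightarrow> real" and a :: "nat \<Rightarrow> complex"
  assumes q: "continuous_on UNIV q"
    and G: "\<And>w. (\<lambda>m. a m * w ^ m) sums G w"
  shows "(LINT z:ball 0 R|lborel. of_real (q (norm z)) * cnj (zeta z) ^ j * G (zeta z)) =
     a j * of_real (LINT z:ball (0 :: real \<times> real) R|lborel. q (norm z) * (norm z) ^ (2 * j))"
proof -
  have qm [measurable]: "q \<in> borel_measurable borel" using q by (rule borel_measurable_continuous_onI)
  define F where "F m z = indicator (ball 0 R) z *\<^sub>R (of_real (q (norm z)) * cnj (zeta z) ^ j * (a m * zeta z ^ m))" for m z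
  have cont: "continuous_on UNIV (\<lambda>z. of_real (q (norm z)) * cnj (zeta z) ^ j * (a m * zeta z ^ m))" for m
    by (intro continuous_intros continuous_on_compose2[OF q]) auto
  have int: "integrable lborel (F m)" for m
    using set_integrable_disc_continuous[OF cont] unfolding F_def set_integrable_def .
  have F: "F m z = a m * (indicator (ball 0 R) z *\<^sub>R (of_real (q (norm z)) * cnj (zeta z) ^ j * zeta z ^ m))" for m z
    unfolding F_def by (simp add: mult_ac)
  have IF: "integral\<^sup>L lborel (F m) = (if m = j then a j * of_real (LINT z:ball (0 :: real \<times> real) R|lborel. q (norm z) * (norm z) ^ (2 * j)) else 0)" for m
  proof (cases "m = j")
    case True
    have "cnj (zeta z) * zeta z = of_real ((norm z)\<^sup>2)" for z
      using complex_norm_square[of "zeta z"] by (simp only: norm_zeta mult.commute)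
    then have "cnj (zeta z) ^ j * zeta z ^ j = of_real ((norm z) ^ (2 * j))" for z
      by (simp only: power_mult_distrib[symmetric] power_mult of_real_power)
    then have "F m z = a j * of_real (indicator (ball 0 R) z * (q (norm z) * (norm z) ^ (2 * j)))" for z
      unfolding F True by (simp only: scaleR_conv_of_real of_real_mult mult.assoc)
    then have "F m = (\<lambda>z. a j * of_real (indicator (ball 0 R) z * (q (norm z) * (norm z) ^ (2 * j))))" ..
    then have "integral\<^sup>L lborel (F m) = a j * of_real (LINT z|lborel. indicator (ball (0 :: real \<times> real) R) z * (q (norm z) * (norm z) ^ (2 * j)))"
      by (simp only: integral_mult_right_zero integral_complex_of_real)
    then show ?thesis
      using True by (simp add: set_lebesgue_integral_def)
  next
    case False
    then show ?thesis
      using disc_integral_monomial_eq_0[OF False qm, of R]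
      unfolding F set_lebesgue_integral_def integral_mult_right_zero by simp
  qed
  obtain K where K: "\<And>z. z \<in> ball 0 R \<Longrightarrow> norm (of_real (q (norm z)) * cnj (zeta z) ^ j) \<le> K"
  proof -
    have "compact ((\<lambda>z. of_real (q (norm z)) * cnj (zeta z) ^ j) ` cball 0 R)"
      by (intro compact_continuous_image continuous_intros continuous_on_compose2[OF q]) auto
    from compact_imp_bounded[OF this] obtain K
      where "\<And>z. z \<in> cball 0 R \<Longrightarrow> norm (of_real (q (norm z)) * cnj (zeta z) ^ j) \<le> K"
      unfolding bounded_iff by blast
    then show ?thesis using that[of K] by auto
  qed
  have sumR: "summable (\<lambda>m. norm (a m) * \<bar>R\<bar> ^ m)"
  proof -
    have "summable (\<lambda>m. a m * of_real (\<bar>R\<bar> + 1) ^ m)" using G sums_summable by blast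
    then have "summable (\<lambda>m. norm (a m * of_real \<bar>R\<bar> ^ m))"
      by (rule powser_insidea) simp
    then show ?thesis by (simp add: norm_mult norm_power)
  qed
  have FB: "norm (F m z) \<le> indicator (ball 0 R) z * (K * (norm (a m) * \<bar>R\<bar> ^ m))" for m z
  proof (cases "z \<in> ball 0 R")
    case True
    then have "norm (zeta z) ^ m \<le> \<bar>R\<bar> ^ m" unfolding norm_zeta by (intro power_mono) auto
    then have "norm (a m * zeta z ^ m) \<le> norm (a m) * \<bar>R\<bar> ^ m"
      by (simp add: norm_mult norm_power mult_left_mono)
    with K[OF True] have "norm (of_real (q (norm z)) * cnj (zeta z) ^ j) * norm (a m * zeta z ^ m) \<le> K * (norm (a m) * \<bar>R\<bar> ^ m)"
      by (intro mult_mono) (auto intro: order_trans[OF norm_ge_zero])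
    then show ?thesis using True unfolding F_def norm_scaleR norm_mult[symmetric] by simp
  qed (simp add: F_def)
  have sumF: "summable (\<lambda>m. norm (F m z))" for z
    by (rule summable_comparison_test'[where N = 0, OF summable_mult[OF summable_mult[OF sumR]]])
       (use FB in simp)
  have sumI: "summable (\<lambda>m. LINT z|lborel. norm (F m z))"
  proof (rule summable_comparison_test'[where N = 0])
    show "summable (\<lambda>m. measure lborel (ball (0 :: real \<times> real) R) * (K * (norm (a m) * \<bar>R\<bar> ^ m)))"
      by (intro summable_mult sumR)
    fix m
    have fin: "emeasure lborel (ball (0 :: real \<times> real) R) < \<infinity>"
      by (rule emeasure_lborel_ball_finite)
    have "(LINT z|lborel. norm (F m z)) \<le> (LINT z|lborel. indicator (ball (0 :: real \<times> real) R) z * (K * (norm (a m) * \<bar>R\<bar> ^ m)))"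
      by (rule integral_mono) (use int FB fin in \<open>auto\<close>)
    also have "\<dots> = measure lborel (ball (0 :: real \<times> real) R) * (K * (norm (a m) * \<bar>R\<bar> ^ m))"
      using fin by simp
    finally show "norm (LINT z|lborel. norm (F m z)) \<le> measure lborel (ball (0 :: real \<times> real) R) * (K * (norm (a m) * \<bar>R\<bar> ^ m))"
      by simp
  qed
  have suminf: "(\<Sum>m. F m z) = indicator (ball 0 R) z *\<^sub>R (of_real (q (norm z)) * cnj (zeta z) ^ j * G (zeta z))" for z
    unfolding F_def by (intro sums_unique[symmetric] sums_scaleR_right sums_mult G)
  have "(LINT z:ball 0 R|lborel. of_real (q (norm z)) * cnj (zeta z) ^ j * G (zeta z)) = (LINT z|lborel. (\<Sum>m. F m z))"
    unfolding set_lebesgue_integral_def suminf ..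
  also have "\<dots> = (\<Sum>m. integral\<^sup>L lborel (F m))"
    by (rule integral_suminf[OF int _ sumI]) (simp add: sumF)
  also have "\<dots> = (\<Sum>m\<in>{j}. integral\<^sup>L lborel (F m))"
    by (rule suminf_finite) (auto simp: IF)
  also have "\<dots> = a j * of_real (LINT z:ball (0 :: real \<times> real) R|lborel. q (norm z) * (norm z) ^ (2 * j))"
    by (simp add: IF)
  finally show ?thesis .
qed

section \<open>The local reproducing formula\<close>

lemma set_integral_sum:
  fixes g :: "'k \<Rightarrow> 'a \<Rightarrow> 'b::{banach, second_countable_topology}"
  assumes "\<And>k. k \<in> A \<Longrightarrow> set_integrable M S (g k)"
  shows "(LINT x:S|M. \<Sum>k\<in>A. g k x) = (\<Sum>k\<in>A. LINT x:S|M. g k x)"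
  unfolding set_lebesgue_integral_def scaleR_sum_right
  using assms by (intro Bochner_Integration.integral_sum) (simp add: set_integrable_def)

lemma tempered_gabor_sums:
  assumes f: "tempered_distribution f"
  shows "(\<lambda>m. f (gabor x0 \<xi>0 (k + m) 0) / (fact m * 2 ^ m) * w ^ m) sums f (gabor x0 \<xi>0 k (w / 2))"
proof -
  define \<Phi> where "\<Phi> n u = f (gabor x0 \<xi>0 n u)" for n u
  have D: "(\<Phi> n has_field_derivative \<Phi> (Suc n) u) (at u)" for n u
    unfolding \<Phi>_def by (rule tempered_gabor_has_field_derivative[OF f])
  have deriv: "(deriv ^^ m) (\<Phi> k) = \<Phi> (k + m)" for m
  proof (induction m)
    case (Suc m)
    have "deriv (\<Phi> n) = \<Phi> (Suc n)" for n
      by (rule ext) (rule DERIV_imp_deriv[OF D])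
    with Suc show ?case by simp
  qed simp
  have "\<Phi> k holomorphic_on ball 0 (norm (w / 2) + 1)"
    by (intro holomorphic_onI) (use D field_differentiable_at_within field_differentiable_def in blast)
  then have "(\<lambda>m. (deriv ^^ m) (\<Phi> k) 0 / fact m * (w / 2 - 0) ^ m) sums \<Phi> k (w / 2)"
    by (rule holomorphic_power_series) simp
  then show ?thesis
    unfolding deriv by (simp add: \<Phi>_def power_divide)
qed

lemma continuous_on_tempered_gabor:
  assumes f: "tempered_distribution f" and g: "continuous_on A g"
  shows "continuous_on A (\<lambda>x. f (gabor x0 \<xi>0 k (g x)))"
proof -
  have "continuous_on UNIV (\<lambda>u. f (gabor x0 \<xi>0 k u))"
    using DERIV_isCont[OF tempered_gabor_has_field_derivative[OF f]]
    by (simp add: continuous_on_eq_continuous_at)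
  from continuous_on_compose2[OF this g] show ?thesis by simp
qed

lemma continuous_on_laguerre [continuous_intros]:
  "continuous_on A g \<Longrightarrow> continuous_on A (\<lambda>x. laguerre r (g x))"
  unfolding laguerre_def by (intro continuous_intros) auto

lemma continuous_on_stft_hermite:
  assumes f: "tempered_distribution f"
  shows "continuous_on UNIV (stft (hermite r) f)"
proof -
  have eq: "stft (hermite r) f = (\<lambda>z. of_real (hermite_norm r) * exp (- (\<i> * of_real (pi * snd z * fst z))) *
      of_real (exp (- pi * ((fst z)\<^sup>2 + (snd z)\<^sup>2) / 2)) *
      (\<Sum>k\<le>r. of_nat (r choose k) * (- (2 * of_real pi * cnj (zeta z))) ^ (r - k) * f (gabor 0 0 k (zeta z / 2))))"
  proof
    fix z :: "real \<times> real"
    show "stft (hermite r) f z = of_real (hermite_norm r) * exp (- (\<i> * of_real (pi * snd z * fst z))) *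
      of_real (exp (- pi * ((fst z)\<^sup>2 + (snd z)\<^sup>2) / 2)) *
      (\<Sum>k\<le>r. of_nat (r choose k) * (- (2 * of_real pi * cnj (zeta z))) ^ (r - k) * f (gabor 0 0 k (zeta z / 2)))"
      using stft_hermite_expansion[OF f, of r 0 "fst z" 0 "snd z"] by simp
  qed
  show ?thesis
    by (subst eq) (intro continuous_intros continuous_on_tempered_gabor f; simp)
qed

text \<open>The conjugate phase of the transform at \<open>z + w\<close> times the radial profile of \<open>V\<^bsub>h\<^esub>h\<close>, \<open>h = h\<^sub>r\<close>: up to
  a phase this is the reproducing kernel.\<close>

definition sieve_kernel :: "nat \<Rightarrow> real \<times> real \<Rightarrow> real \<times> real \<Rightarrow> complex" where
  "sieve_kernel r z w = exp (\<i> * of_real (pi * snd w * (2 * fst z + fst w))) *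
     of_real (laguerre r (pi * (norm w)\<^sup>2) * exp (- (pi * (norm w)\<^sup>2) / 2))"

lemma norm_sieve_kernel_le: "norm (sieve_kernel r z w) \<le> 1"
  using abs_laguerre_le[of "pi * (norm w)\<^sup>2" r]
  unfolding sieve_kernel_def norm_mult by (simp add: norm_mult)

text \<open>The local reproducing formula. The phase of the kernel cancels that of the transform, and the
  two Gaussian factors combine to \<open>exp (- \<pi> |w|\<^sup>2)\<close>. In the \<open>k\<close>-th summand of the expansion,
  \<open>disc_integral_power_series\<close> picks the Taylor coefficient of order \<open>r - k\<close> of
  \<open>\<Phi>\<^sub>k(\<cdot>/2)\<close>, which is \<open>\<Phi>\<^sub>r(0)\<close> over \<open>(r - k)! 2\<close> to the power \<open>r - k\<close>: the same number \<open>\<Phi>\<^sub>r(0)\<close> for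
  all \<open>k\<close>. The factors multiplying it sum to a second Laguerre polynomial.\<close>

lemma disc_integral_stft_hermite:
  assumes f: "tempered_distribution f" and R: "0 < R"
  shows "(LINT w:ball 0 R|lborel. sieve_kernel r z w * stft (hermite r) f (z + w)) =
     of_real (sieve_const r R) * stft (hermite r) f z"
proof -
  obtain x0 \<xi>0 where z: "z = (x0, \<xi>0)" by (cases z)
  define \<Phi> where "\<Phi> k u = f (gabor x0 \<xi>0 k u)" for k u
  define q where "q s = laguerre r (pi * s\<^sup>2) * exp (- (pi * s\<^sup>2))" for s
  define b where "b k = of_nat (r choose k) * (- (2 * complex_of_real pi)) ^ (r - k)" for k
  define J where "J k = (LINT w:ball (0 :: real \<times> real) R|lborel. q (norm w) * (norm w) ^ (2 * (r - k)))" for k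
  have q: "continuous_on UNIV q" unfolding q_def[abs_def] by (intro continuous_intros)
  have expansion: "sieve_kernel r z w * stft (hermite r) f (z + w) = of_real (hermite_norm r) *
      (\<Sum>k\<le>r. b k * (of_real (q (norm w)) * cnj (zeta w) ^ (r - k) * \<Phi> k (zeta w / 2)))" for w
  proof -
    obtain x \<xi> where w: "w = (x, \<xi>)" by (cases w)
    have n: "x\<^sup>2 + \<xi>\<^sup>2 = (norm w)\<^sup>2" by (simp add: w norm_prod_def)
    define e where "e = \<i> * complex_of_real (pi * \<xi> * (2 * x0 + x))"
    have "sieve_kernel r z w = exp e * of_real (laguerre r (pi * (norm w)\<^sup>2) * exp (- (pi * (norm w)\<^sup>2) / 2))"
      by (simp add: sieve_kernel_def w z e_def)
    moreover have "stft (hermite r) f (z + w) = of_real (hermite_norm r) * exp (- e) *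
       of_real (exp (- (pi * (norm w)\<^sup>2) / 2)) *
      (\<Sum>k\<le>r. b k * cnj (zeta w) ^ (r - k) * \<Phi> k (zeta w / 2))"
    proof -
      have "(- (2 * of_real pi * cnj (zeta w))) ^ n = (- (2 * of_real pi)) ^ n * cnj (zeta w) ^ n" for n
        by (simp flip: power_mult_distrib)
      then show ?thesis
        using stft_hermite_expansion[OF f, of r x0 x \<xi>0 \<xi>]
        by (simp add: z w e_def n[unfolded w] b_def \<Phi>_def mult.assoc)
    qed
    ultimately have "sieve_kernel r z w * stft (hermite r) f (z + w) = of_real (hermite_norm r) * (exp e * exp (- e)) *
       of_real (laguerre r (pi * (norm w)\<^sup>2) * (exp (- (pi * (norm w)\<^sup>2) / 2) * exp (- (pi * (norm w)\<^sup>2) / 2))) *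
      (\<Sum>k\<le>r. b k * cnj (zeta w) ^ (r - k) * \<Phi> k (zeta w / 2))"
      by (simp only: of_real_mult mult_ac)
    also have "exp e * exp (- e) = 1" by (simp flip: exp_add)
    also have "laguerre r (pi * (norm w)\<^sup>2) * (exp (- (pi * (norm w)\<^sup>2) / 2) * exp (- (pi * (norm w)\<^sup>2) / 2)) = q (norm w)"
      unfolding q_def by (simp flip: exp_add)
    finally show ?thesis
      by (simp add: sum_distrib_left mult_ac)
  qed
  have int: "set_integrable lborel (ball 0 R) (\<lambda>w. of_real (q (norm w)) * cnj (zeta w) ^ (r - k) * \<Phi> k (zeta w / 2))" for k
    unfolding \<Phi>_def
    by (intro set_integrable_disc_continuous continuous_intros continuous_on_tempered_gabor f continuous_on_compose2[OF q]) auto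
  have term_k: "(LINT w:ball 0 R|lborel. of_real (q (norm w)) * cnj (zeta w) ^ (r - k) * \<Phi> k (zeta w / 2))
      = \<Phi> r 0 / (fact (r - k) * 2 ^ (r - k)) * of_real (J k)" if "k \<le> r" for k
    using disc_integral_power_series[OF q tempered_gabor_sums[OF f, of x0 \<xi>0 k], of R "r - k"] that
    by (simp add: \<Phi>_def J_def)
  have const: "(\<Sum>k\<le>r. b k / (fact (r - k) * 2 ^ (r - k)) * of_real (J k)) = of_real (sieve_const r R)"
  proof -
    have "b k / (fact (r - k) * 2 ^ (r - k)) = of_real (real (r choose k) * (- pi) ^ (r - k) / fact (r - k))" for k
    proof -
      have "(- (2 * complex_of_real pi)) ^ (r - k) = of_real ((- pi) ^ (r - k)) * 2 ^ (r - k)"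
        by (simp flip: power_mult_distrib add: mult.commute)
      then show ?thesis by (simp add: b_def)
    qed
    then have "(\<Sum>k\<le>r. b k / (fact (r - k) * 2 ^ (r - k)) * of_real (J k)) =
        of_real (\<Sum>k\<le>r. real (r choose k) * (- pi) ^ (r - k) / fact (r - k) * J k)"
      by simp
    also have "(\<Sum>k\<le>r. real (r choose k) * (- pi) ^ (r - k) / fact (r - k) * J k) =
        (LINT w:ball (0 :: real \<times> real) R|lborel. \<Sum>k\<le>r. real (r choose k) * (- pi) ^ (r - k) / fact (r - k) * (q (norm w) * (norm w) ^ (2 * (r - k))))"
    proof -
      have "set_integrable lborel (ball (0 :: real \<times> real) R) (\<lambda>w. q (norm w) * (norm w) ^ (2 * (r - k)))" for k
        by (intro set_integrable_disc_continuous continuous_intros continuous_on_compose2[OF q]) auto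
      then show ?thesis
        unfolding J_def by (subst set_integral_sum) simp_all
    qed
    also have "\<dots> = (LINT w:ball (0 :: real \<times> real) R|lborel. (laguerre r (pi * (norm w)\<^sup>2))\<^sup>2 * exp (- (pi * (norm w)\<^sup>2)))"
    proof (intro set_lebesgue_integral_cong allI impI)
      fix w :: "real \<times> real"
      have "real (r choose k) * (- pi) ^ (r - k) / fact (r - k) * (q (norm w) * (norm w) ^ (2 * (r - k)))
          = q (norm w) * (real (r choose k) * (- (pi * (norm w)\<^sup>2)) ^ (r - k) / fact (r - k))" for k
      proof -
        have "(- (pi * (norm w)\<^sup>2)) ^ (r - k) = (- pi) ^ (r - k) * (norm w) ^ (2 * (r - k))"
          unfolding power_mult power_mult_distrib[symmetric] by simp
        then show ?thesis by simp
      qed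
      then show "(\<Sum>k\<le>r. real (r choose k) * (- pi) ^ (r - k) / fact (r - k) * (q (norm w) * (norm w) ^ (2 * (r - k))))
         = (laguerre r (pi * (norm w)\<^sup>2))\<^sup>2 * exp (- (pi * (norm w)\<^sup>2))"
        by (simp only: sum_distrib_left[symmetric] laguerre_alt[symmetric]) (simp add: q_def power2_eq_square)
    qed simp
    also have "\<dots> = sieve_const r R"
      unfolding sieve_const_def
      by (rule disc_integral_radial[OF R, of "\<lambda>t. (laguerre r t)\<^sup>2 * exp (- t)"])
         (intro borel_measurable_continuous_onI continuous_intros)
    finally show ?thesis .
  qed
  \<comment> \<open>the expansion at \<open>w = 0\<close>, where only \<open>k = r\<close> survives\<close>
  have "stft (hermite r) f z = of_real (hermite_norm r) * (\<Sum>k\<le>r. of_nat (r choose k) * 0 ^ (r - k) * \<Phi> k 0)"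
    using stft_hermite_expansion[OF f, of r x0 0 \<xi>0 0]
    by (simp add: z \<Phi>_def Complex_eq_0 flip: zero_complex.code)
  also have "(\<Sum>k\<le>r. of_nat (r choose k) * 0 ^ (r - k) * \<Phi> k 0) = (\<Sum>k\<le>r. if k = r then \<Phi> r 0 else 0)"
    by (intro sum.cong) (auto simp: power_0_left)
  finally have centre: "stft (hermite r) f z = of_real (hermite_norm r) * \<Phi> r 0" by simp
  have "(LINT w:ball 0 R|lborel. sieve_kernel r z w * stft (hermite r) f (z + w)) =
     of_real (hermite_norm r) * (\<Sum>k\<le>r. b k * (LINT w:ball 0 R|lborel. of_real (q (norm w)) * cnj (zeta w) ^ (r - k) * \<Phi> k (zeta w / 2)))"
    unfolding expansion set_integral_mult_right
    by (subst set_integral_sum) (simp_all add: int)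
  also have "\<dots> = of_real (hermite_norm r) * (\<Sum>k\<le>r. \<Phi> r 0 * (b k / (fact (r - k) * 2 ^ (r - k)) * of_real (J k)))"
    by (intro arg_cong[of _ _ "\<lambda>s. of_real (hermite_norm r) * s"] sum.cong refl) (simp add: term_k)
  also have "\<dots> = of_real (sieve_const r R) * stft (hermite r) f z"
    unfolding centre sum_distrib_left[symmetric] const by (simp only: mult_ac)
  finally show ?thesis .
qed

text \<open>The integrand is continuous and equals 1 at \<open>0\<close>.\<close>

lemma sieve_const_pos:
  assumes "0 < R"
  shows "0 < sieve_const r R"
proof -
  define h where "h t = (laguerre r t)\<^sup>2 * exp (- t)" for t
  have cont: "continuous_on A h" for A unfolding h_def[abs_def] by (intro continuous_intros)
  have "set_integrable lborel {0..pi * R\<^sup>2} h"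
    unfolding set_integrable_def by (rule borel_integrable_compact) (auto intro: cont)
  then have eq: "sieve_const r R = integral {0..pi * R\<^sup>2} h"
    unfolding sieve_const_def h_def[symmetric] by (rule set_borel_integral_eq_integral)
  have "laguerre r 0 = 1"
    unfolding laguerre_def by (subst sum.remove[of _ 0]) (auto intro!: sum.neutral)
  then have "h 0 \<noteq> 0" by (simp add: h_def)
  moreover have "0 \<in> {0..pi * R\<^sup>2}" by simp
  ultimately have "integral {0..pi * R\<^sup>2} h \<noteq> 0"
    using assms integral_eq_0_iff[OF cont, of 0 "pi * R\<^sup>2"] by (auto simp: h_def)
  moreover have "integral {0..pi * R\<^sup>2} h \<ge> 0"
    by (rule Henstock_Kurzweil_Integration.integral_nonneg[OF integrable_continuous_real[OF cont]]) (simp add: h_def)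
  ultimately show ?thesis unfolding eq by simp
qed

lemma sieve_pointwise:
  assumes f: "tempered_distribution f" and R: "0 < R"
  shows "ennreal (sieve_const r R) * ennreal (norm (stft (hermite r) f z)) \<le>
     (\<integral>\<^sup>+w. (if dist z w < R then ennreal (norm (stft (hermite r) f w)) else 0) \<partial>lborel)"
proof -
  let ?F = "stft (hermite r) f"
  have [measurable]: "?F \<in> borel_measurable borel"
    by (rule borel_measurable_continuous_onI[OF continuous_on_stft_hermite[OF f]])
  define g where "g w = indicator (ball 0 R) w *\<^sub>R (sieve_kernel r z w * ?F (z + w))" for w
  have "integrable lborel g"
  proof -
    have "continuous_on UNIV (\<lambda>w. sieve_kernel r z w * ?F (z + w))"
      unfolding sieve_kernel_def
      by (intro continuous_intros continuous_on_compose2[OF continuous_on_stft_hermite[OF f]]) auto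
    from set_integrable_disc_continuous[OF this] show ?thesis
      unfolding g_def set_integrable_def .
  qed
  have "ennreal (sieve_const r R) * ennreal (norm (?F z)) = ennreal (norm (integral\<^sup>L lborel g))"
    using disc_integral_stft_hermite[OF f R, of r z] sieve_const_pos[OF R, of r]
    unfolding g_def set_lebesgue_integral_def by (simp add: norm_mult ennreal_mult)
  also have "\<dots> \<le> (\<integral>\<^sup>+w. norm (g w) \<partial>lborel)"
    by (rule integral_norm_bound_ennreal) fact
  also have "\<dots> \<le> (\<integral>\<^sup>+w. (if dist z (z + w) < R then ennreal (norm (?F (z + w))) else 0) \<partial>lborel)"
  proof (rule nn_integral_mono)
    fix w
    have "norm (sieve_kernel r z w * ?F (z + w)) \<le> norm (?F (z + w))"
      using mult_right_mono[OF norm_sieve_kernel_le[of r z w], of "norm (?F (z + w))"] by (simp add: norm_mult)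
    then show "ennreal (norm (g w)) \<le> (if dist z (z + w) < R then ennreal (norm (?F (z + w))) else 0)"
      by (auto simp: g_def dist_norm indicator_def intro!: ennreal_leI)
  qed
  also have "\<dots> = (\<integral>\<^sup>+w. (if dist z w < R then ennreal (norm (?F w)) else 0) \<partial>distr lborel borel ((+) z))"
    by (subst nn_integral_distr) auto
  finally show ?thesis by (simp only: lborel_distr_plus)
qed

section \<open>The large sieve inequality\<close>

theorem mainTheorem1:
  fixes r :: nat
    and \<Delta> :: "(real \<times> real) set"
    and f :: "(real \<Rightarrow> complex) \<Rightarrow> complex"
    and R :: real
  assumes "\<Delta> \<in> sets lebesgue"
    and "f \<in> modulation_space_1"
    and "0 < R"
  shows "L1_norm (\<lambda>z. stft (hermite r) f z * indicator \<Delta> z)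
    \<le> max_density \<Delta> R / ennreal (sieve_const r R) * L1_norm (stft (hermite r) f)"
proof -
  let ?F = "stft (hermite r) f" and ?C = "ennreal (sieve_const r R)" and ?\<rho> = "max_density \<Delta> R"
  have f: "tempered_distribution f" using assms(2) by (simp add: modulation_space_1_def)
  have [measurable]: "?F \<in> borel_measurable borel"
    by (rule borel_measurable_continuous_onI[OF continuous_on_stft_hermite[OF f]])
  \<comment> \<open>Fubini needs a Borel set, which \<open>\<Delta>\<close> is up to a null set\<close>
  obtain S N N' where S: "\<Delta> = S \<union> N" "N \<subseteq> N'" "N' \<in> null_sets lborel" "S \<in> sets lborel"
    using assms(1) by (rule sets_completionE)
  have [measurable]: "S \<in> sets borel" using S(4) by simp
  have local_density: "emeasure lborel (S \<inter> ball w R) \<le> ?\<rho>" for w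
  proof -
    have "emeasure lborel (S \<inter> ball w R) = emeasure lebesgue (S \<inter> ball w R)" by simp
    also have "\<dots> \<le> emeasure lebesgue (\<Delta> \<inter> ball w R)"
      using S(1) assms(1) by (intro emeasure_mono) auto
    also have "\<dots> \<le> ?\<rho>"
      unfolding max_density_def by (rule SUP_upper) simp
    finally show ?thesis .
  qed
  have "L1_norm (\<lambda>z. ?F z * indicator \<Delta> z) = (\<integral>\<^sup>+z. ennreal (norm (?F z * indicator \<Delta> z)) \<partial>lborel)"
    unfolding L1_norm_def by (rule nn_integral_completion)
  also have "\<dots> = (\<integral>\<^sup>+z. indicator S z * ennreal (norm (?F z)) \<partial>lborel)"
  proof (rule nn_integral_cong_AE)
    from S(3) have "AE z in lborel. z \<notin> N'" by (rule AE_not_in)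
    then show "AE z in lborel. ennreal (norm (?F z * indicator \<Delta> z)) = indicator S z * ennreal (norm (?F z))"
      by eventually_elim (use S(1,2) in \<open>auto simp: indicator_def\<close>)
  qed
  finally have norm_\<Delta>: "L1_norm (\<lambda>z. ?F z * indicator \<Delta> z) = (\<integral>\<^sup>+z. indicator S z * ennreal (norm (?F z)) \<partial>lborel)" .
  have "?C * L1_norm (\<lambda>z. ?F z * indicator \<Delta> z) = (\<integral>\<^sup>+z. indicator S z * (?C * ennreal (norm (?F z))) \<partial>lborel)"
    unfolding norm_\<Delta> by (subst nn_integral_cmult[symmetric]) (simp_all add: mult_ac)
  also have "\<dots> \<le> (\<integral>\<^sup>+z. indicator S z * (\<integral>\<^sup>+w. (if dist z w < R then ennreal (norm (?F w)) else 0) \<partial>lborel) \<partial>lborel)"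
    by (intro nn_integral_mono mult_left_mono sieve_pointwise f assms) simp
  also have "\<dots> = (\<integral>\<^sup>+z. \<integral>\<^sup>+w. indicator S z * (if dist z w < R then ennreal (norm (?F w)) else 0) \<partial>lborel \<partial>lborel)"
    by (intro nn_integral_cong nn_integral_cmult[symmetric]) simp
  also have "\<dots> = (\<integral>\<^sup>+w. \<integral>\<^sup>+z. indicator S z * (if dist z w < R then ennreal (norm (?F w)) else 0) \<partial>lborel \<partial>lborel)"
    by (rule lborel_pair.Fubini'[symmetric]) simp
  also have "\<dots> = (\<integral>\<^sup>+w. emeasure lborel (S \<inter> ball w R) * ennreal (norm (?F w)) \<partial>lborel)"
  proof (rule nn_integral_cong)
    fix w
    have [measurable]: "S \<inter> ball w R \<in> sets borel" by simp
    have "(\<integral>\<^sup>+z. indicator S z * (if dist z w < R then ennreal (norm (?F w)) else 0) \<partial>lborel) =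
       (\<integral>\<^sup>+z. indicator (S \<inter> ball w R) z * ennreal (norm (?F w)) \<partial>lborel)"
      by (intro nn_integral_cong) (auto simp: indicator_def dist_commute)
    also have "\<dots> = emeasure lborel (S \<inter> ball w R) * ennreal (norm (?F w))"
      by (subst nn_integral_multc) simp_all
    finally show "(\<integral>\<^sup>+z. indicator S z * (if dist z w < R then ennreal (norm (?F w)) else 0) \<partial>lborel) =
       emeasure lborel (S \<inter> ball w R) * ennreal (norm (?F w))" .
  qed
  also have "\<dots> \<le> (\<integral>\<^sup>+w. ?\<rho> * ennreal (norm (?F w)) \<partial>lborel)"
    by (intro nn_integral_mono mult_right_mono local_density) simp
  also have "\<dots> = ?\<rho> * L1_norm ?F"
    unfolding L1_norm_def by (simp add: nn_integral_cmult nn_integral_completion)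
  finally have "?C * L1_norm (\<lambda>z. ?F z * indicator \<Delta> z) \<le> ?\<rho> * L1_norm ?F" .
  then have "L1_norm (\<lambda>z. ?F z * indicator \<Delta> z) * ?C / ?C \<le> ?\<rho> * L1_norm ?F / ?C"
    by (intro divide_right_mono_ennreal) (simp only: mult.commute)
  moreover have "L1_norm (\<lambda>z. ?F z * indicator \<Delta> z) * ?C / ?C = L1_norm (\<lambda>z. ?F z * indicator \<Delta> z)"
    using sieve_const_pos[OF assms(3), of r] by (intro ennreal_mult_divide_eq) auto
  ultimately show ?thesis
    by (simp only: ennreal_divide_times ennreal_times_divide)
qed

end
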